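(* The following hold, where all counts are the exact numbers of codes up to equivalence. (i) There are $3$ inequivalent ternary optimal LCD $[13s,3]$ codes with dual distances $d^\perp\ge 2$ for every integer $s\ge 1$. (ii) There are $144$ inequivalent ternary optimal LCD $[13s+1,3]$ codes with dual distances $d^\perp\ge 2$ for every integer $s\ge 3$. (iii) Suppose that $t\in\{2,12\}$. Then there are $15$ inequivalent ternary optimal LCD $[13s+t,3]$ codes with dual distances $d^\perp\ge 2$ for every integer $s\ge 2$ if $t=2$ and for every integer $s\ge 1$ if $t=12$. (iv) Suppose that $t\in\{3,6\}$. Then there are $4$ inequivalent ternary optimal LCD $[13s+t,3]$ codes with dual distances $d^\perp\ge 2$ for every integer $s\ge 1$. (v) Suppose that $t\in\{4,7,10\}$. Then there is a unique ternary optimal LCD $[13s+t,3]$ code with dual distance $d^\perp\ge 2$, up to equivalence, for every integer $s\ge 0$. (vi) There are $45$ inequivalent ternary optimal LCD $[13s+5,3]$ codes with dual distances $d^\perp\ge 2$ for every integer $s\ge 2$. (vii) Suppose that $t\in\{8,11\}$. Then there are $54$ inequivalent ternary optimal LCD $[13s+t,3]$ codes with dual distances $d^\perp\ge 2$ for every integer $s\ge 2$. (viii) There are $13$ inequivalent ternary optimal LCD $[13s+9,3]$ codes with dual distances $d^\perp\ge 2$ for every integer $s\ge 1$.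
   Context: A ternary $[n,k]$ code is a $k$-dimensional subspace $C$ of $\mathbb{F}_3^n$; an $[n,k,d]$ code is one whose minimum weight (the smallest Hamming weight of a nonzero codeword) is exactly $d$. The dual code is $C^\perp=\{x\in\mathbb{F}_3^n: x\cdot y=0 \text{ for all } y\in C\}$ for the standard inner product. $C$ is LCD (linear complementary dual) if $C\cap C^\perp=\{0\}$. The dual distance $d^\perp$ of $C$ is the minimum weight of $C^\perp$. Two ternary $[n,k]$ codes $C_1,C_2$ are equivalent if $C_2=\{cP: c\in C_1\}$ for some $n\times n$ monomial matrix $P$ over $\mathbb{F}_3$. Let $d_3(n,k)$ be the largest $d$ such that a ternary LCD $[n,k,d]$ code exists; an LCD $[n,k,d_3(n,k)]$ code is called optimal. (One has, for $n\ge 3$, $d_3(n,3)=\lfloor 9n/13\rfloor$ if $n\equiv 4,7,10\pmod{13}$ and $d_3(n,3)=\lfloor 9n/13\rfloor-1$ otherwise.) *)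

theory Defs
  imports "Jordan_Normal_Form.VS_Connect"
begin

text \<open>The three-element field: \<^typ>\<open>Enum.finite_3\<close> carries a \<^class>\<open>field\<close> instance,
  with elements 0, 1 and 2 = -1.\<close>

type_synonym gf3 = Enum.finite_3

definition ternary_code :: "nat \<Rightarrow> nat \<Rightarrow> gf3 vec set \<Rightarrow> bool" where
  "ternary_code n k C \<longleftrightarrow>
     VectorSpace.subspace class_ring C (module_vec TYPE(gf3) n) \<and>
     vectorspace.dim class_ring ((module_vec TYPE(gf3) n)\<lparr>carrier := C\<rparr>) = k"

definition hamming_weight :: "'a :: zero vec \<Rightarrow> nat" where
  "hamming_weight v = card {i. i < dim_vec v \<and> v $ i \<noteq> 0}"

text \<open>Unspecified if \<open>C\<close> has no nonzero codeword.\<close>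

definition min_weight :: "gf3 vec set \<Rightarrow> nat" where
  "min_weight C = Min (hamming_weight ` {c \<in> C. c \<noteq> 0\<^sub>v (dim_vec c)})"

definition dual_code :: "nat \<Rightarrow> gf3 vec set \<Rightarrow> gf3 vec set" where
  "dual_code n C = {x \<in> carrier_vec n. \<forall>y\<in>C. x \<bullet> y = 0}"

text \<open>Unspecified if the dual code is zero, i.e. if the dimension of \<open>C\<close> is \<open>n\<close>.\<close>

definition dual_distance :: "nat \<Rightarrow> gf3 vec set \<Rightarrow> nat" where
  "dual_distance n C = min_weight (dual_code n C)"

definition lcd :: "nat \<Rightarrow> gf3 vec set \<Rightarrow> bool" where
  "lcd n C \<longleftrightarrow> C \<inter> dual_code n C = {0\<^sub>v n}"

definition lcd_code :: "nat \<Rightarrow> nat \<Rightarrow> nat \<Rightarrow> gf3 vec set \<Rightarrow> bool" where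
  "lcd_code n k d C \<longleftrightarrow> ternary_code n k C \<and> min_weight C = d \<and> lcd n C"

definition d3 :: "nat \<Rightarrow> nat \<Rightarrow> nat" where
  "d3 n k = Max {d. \<exists>C. lcd_code n k d C}"

definition optimal_lcd_code :: "nat \<Rightarrow> nat \<Rightarrow> gf3 vec set \<Rightarrow> bool" where
  "optimal_lcd_code n k C \<longleftrightarrow> lcd_code n k (d3 n k) C"

definition monomial_mat :: "nat \<Rightarrow> gf3 mat \<Rightarrow> bool" where
  "monomial_mat n P \<longleftrightarrow> P \<in> carrier_mat n n \<and>
     (\<forall>i<n. \<exists>!j. j < n \<and> P $$ (i, j) \<noteq> 0) \<and>
     (\<forall>j<n. \<exists>!i. i < n \<and> P $$ (i, j) \<noteq> 0)"

text \<open>Vectors are columns in the library, so the row vector \<open>cP\<close> is \<open>P\<^sup>T *\<^sub>v c\<close>.\<close>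

definition equivalent_codes :: "nat \<Rightarrow> gf3 vec set \<Rightarrow> gf3 vec set \<Rightarrow> bool" where
  "equivalent_codes n C1 C2 \<longleftrightarrow>
     (\<exists>P. monomial_mat n P \<and> C2 = {transpose_mat P *\<^sub>v c | c. c \<in> C1})"

definition optimal_lcd_codes_dd2 :: "nat \<Rightarrow> nat \<Rightarrow> gf3 vec set set" where
  "optimal_lcd_codes_dd2 n k = {C. optimal_lcd_code n k C \<and> dual_distance n C \<ge> 2}"

definition num_inequivalent :: "nat \<Rightarrow> gf3 vec set set \<Rightarrow> nat" where
  "num_inequivalent n S =
     card (S // {(C1, C2). C1 \<in> S \<and> C2 \<in> S \<and> equivalent_codes n C1 C2})"

end

theory Submission
  imports Defs "HOL-Library.Product_Plus" "HOL-Library.List_Lexorder" "HOL-Combinatorics.Permutations"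
begin

text \<open>
  An LCD code of dimension 3 is a nondegenerate quadratic space over the field of three elements, so it
  has an orthogonal basis all of whose vectors have the same norm \<open>e = 1\<close> or \<open>e = -1\<close>
  (\<open>lcd_exists_generator\<close>). With respect to such a basis the weight \<open>W a\<close> of the codeword with coordinates
  \<open>a\<close> is congruent to \<open>e (a \<bullet> a)\<close> modulo 3, because the weight of a word is its norm modulo 3. So
  \<open>W a \<ge> d\<close> improves to \<open>W a = d + r a + 3 f a\<close> with an explicit gap \<open>r a\<close> and a natural number \<open>f a\<close>. In a
  code without zero columns the weights sum up to \<open>9 n\<close> over the 13 points of the projective plane; the
  gaps sum up to at least 10, whence \<open>13 d + 10 \<le> 9 n\<close>. In the optimal case the sum \<open>k\<close> of the \<open>f a\<close> is a
  constant at most 4 that depends only on \<open>e\<close> and on \<open>n\<close> modulo 13; where this constant is negative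
  there is no code of norm \<open>e\<close>.

  The weights determine the number of columns on each line by double counting, hence the code up to
  monomial equivalence (\<open>same_weights_equivalent\<close>). Conversely every \<open>f\<close> with the right sum comes from a
  code as soon as the column multiplicities computed from it are nonnegative, which holds if
  \<open>2 n \<le> 3 d + 2\<close> (\<open>weight_class_realized\<close>); this gives the lower bounds on \<open>s\<close>. Changing the orthogonal
  basis means acting on \<open>f\<close> by one of the 48 orthogonal matrices. So the classes with norm \<open>e\<close> correspond to the
  orbits of this group on the functions \<open>f\<close> from the 13 points to the natural numbers with sum \<open>k\<close>
  (\<open>num_inequivalent_eq_card_orbits\<close>, \<open>card_orbits\<close>). There are 1, 3, 12, 42, 132 orbits
  for \<open>k = 0, ..., 4\<close>, found by listing the functions that are lexicographically least in their
  orbit (\<open>num_canonical_values\<close>), and each count in the theorem is the sum of the contributions of \<open>e = 1\<close> and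
  \<open>e = -1\<close>; for example \<open>144 = 132 + 12\<close>.
\<close>

section \<open>The three-element field and codes given by columns\<close>

text \<open>The simplifier would otherwise replace the field constants by constructors of the enumeration
  type, and no ring lemma would match any more.\<close>

declare zero_finite_3_def [simp del] one_finite_3_def [simp del] two_finite_3 [simp del]

lemma gf3_cases: obtains "x = 0" | "x = 1" | "x = (-1 :: gf3)"
  by (cases x) (auto simp: zero_finite_3_def one_finite_3_def uminus_finite_3_def)

lemma gf3_square: "x * x = (if x = 0 then 0 else 1)" for x :: gf3
  by (cases x rule: gf3_cases) auto

lemma gf3_numeral: "(2 :: gf3) = -1" "(3 :: gf3) = 0"
proof -
  show "(2 :: gf3) = -1" by (simp add: one_finite_3_def uminus_finite_3_def two_finite_3)
  then show "(3 :: gf3) = 0" by (metis add.commute add.right_inverse one_plus_numeral semiring_norm(3))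
qed

lemma gf3_double: "x + x = - x" for x :: gf3
  using gf3_numeral(1) by (metis mult_2 mult_minus1)

lemma UNIV_gf3: "(UNIV :: gf3 set) = {0, 1, -1}"
  by (auto intro: gf3_cases)

lemma card_gf3: "card (UNIV :: gf3 set) = 3"
  unfolding UNIV_gf3 by (simp add: zero_finite_3_def one_finite_3_def uminus_finite_3_def)

lemma gf3_minus_one: "(-1 :: gf3) \<noteq> 1" "(1 :: gf3) \<noteq> -1" "(-1 :: gf3) \<noteq> 0"
  by (simp_all add: zero_finite_3_def one_finite_3_def uminus_finite_3_def)

type_synonym point = "gf3 \<times> gf3 \<times> gf3"

text \<open>A three-dimensional code of length \<open>n\<close> is given by \<open>n\<close> columns of a generator matrix, that is by
  points of the three-dimensional space \<open>V\<close> over the field; its codewords are indexed by \<open>V\<close> as well,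
  through the standard form.\<close>

definition dot :: "point \<Rightarrow> point \<Rightarrow> gf3" where
  "dot a p = fst a * fst p + fst (snd a) * fst (snd p) + snd (snd a) * snd (snd p)"

definition scale :: "gf3 \<Rightarrow> point \<Rightarrow> point" where
  "scale c p = (c * fst p, c * fst (snd p), c * snd (snd p))"

lemma dot_commute: "dot a b = dot b a"
  by (simp add: dot_def mult.commute)

lemma dot_add: "dot (a + b) p = dot a p + dot b p" "dot p (a + b) = dot p a + dot p b"
  by (simp_all add: dot_def algebra_simps)

lemma dot_uminus [simp]: "dot (- a) p = - dot a p" "dot p (- a) = - dot p a"
  by (simp_all add: dot_def algebra_simps)

lemma dot_diff: "dot (a - b) p = dot a p - dot b p" "dot p (a - b) = dot p a - dot p b"
  by (simp_all add: dot_def algebra_simps)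

lemma dot_zero [simp]: "dot 0 p = 0" "dot p 0 = 0"
  by (simp_all add: dot_def)

lemma dot_scale: "dot (scale c a) p = c * dot a p" "dot p (scale c a) = c * dot p a"
  by (simp_all add: dot_def scale_def algebra_simps)

lemma dot_nondegenerate:
  assumes "\<And>b. dot a b = 0" shows "a = 0"
  using assms[of "(1, 0, 0)"] assms[of "(0, 1, 0)"] assms[of "(0, 0, 1)"]
  by (simp add: dot_def prod_eq_iff)

lemma card_point: "card (UNIV :: point set) = 27"
  by (simp add: card_gf3 card_cartesian_product flip: UNIV_Times_UNIV)

definition codeword :: "nat \<Rightarrow> (nat \<Rightarrow> point) \<Rightarrow> point \<Rightarrow> gf3 vec" where
  "codeword n g a = vec n (\<lambda>i. dot a (g i))"

definition weight :: "nat \<Rightarrow> (nat \<Rightarrow> point) \<Rightarrow> point \<Rightarrow> nat" where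
  "weight n g a = card {i. i < n \<and> dot a (g i) \<noteq> 0}"

text \<open>Over three elements a nonzero square is 1, so the weight of a codeword is, modulo 3, its inner
  product with itself. For the weight function of a generator matrix the condition therefore says
  that the Gram matrix is \<open>e\<close> times the identity, but it only mentions weights.\<close>

definition conformal :: "gf3 \<Rightarrow> (point \<Rightarrow> nat) \<Rightarrow> bool" where
  "conformal e W \<longleftrightarrow> e \<noteq> 0 \<and> (\<forall>a. of_nat (W a) = e * dot a a)"

lemma conformalD: "conformal e W \<Longrightarrow> of_nat (W a) = e * dot a a" "conformal e W \<Longrightarrow> e \<noteq> 0"
  unfolding conformal_def by blast+

lemma codeword_carrier [simp]: "codeword n g a \<in> carrier_vec n" "dim_vec (codeword n g a) = n"
  by (simp_all add: codeword_def)

lemma codeword_add: "codeword n g (a + b) = codeword n g a + codeword n g b"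
  by (auto simp: codeword_def dot_add)

lemma codeword_scale: "codeword n g (scale c a) = c \<cdot>\<^sub>v codeword n g a"
  by (auto simp: codeword_def dot_scale)

lemma codeword_0 [simp]: "codeword n g 0 = 0\<^sub>v n"
  by (auto simp: codeword_def)

lemma hamming_weight_codeword: "hamming_weight (codeword n g a) = weight n g a"
  unfolding hamming_weight_def weight_def codeword_def by (rule arg_cong[of _ _ card]) auto

lemma weight_0 [simp]: "weight n g 0 = 0" by (simp add: weight_def)

lemma weight_uminus [simp]: "weight n g (- a) = weight n g a" by (simp add: weight_def)

lemma scalar_prod_self: "v \<bullet> v = of_nat (hamming_weight v)" for v :: "gf3 vec"
proof -
  have "v \<bullet> v = (\<Sum>i<dim_vec v. if v $ i \<noteq> 0 then 1 else 0)"
    unfolding scalar_prod_def by (rule sum.cong) (auto simp: gf3_square)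
  also have "\<dots> = of_nat (hamming_weight v)"
    by (simp add: hamming_weight_def sum.If_cases lessThan_def Collect_conj_eq)
  finally show ?thesis .
qed

text \<open>Polarization, which is available because 2 is invertible.\<close>

lemma conformal_scalar_prod:
  assumes "conformal e (weight n g)"
  shows "codeword n g a \<bullet> codeword n g b = e * dot a b"
proof -
  define x y where "x = codeword n g a" and "y = codeword n g b"
  have xy: "x \<in> carrier_vec n" "y \<in> carrier_vec n" by (simp_all add: x_def y_def)
  have sq: "codeword n g c \<bullet> codeword n g c = e * dot c c" for c
    by (simp only: scalar_prod_self hamming_weight_codeword conformalD[OF assms])
  have "(x + y) \<bullet> (x + y) = e * dot (a + b) (a + b)"
    using sq[of "a + b"] by (simp add: x_def y_def codeword_add)
  moreover have "(x + y) \<bullet> (x + y) = x \<bullet> x + y \<bullet> y + (x \<bullet> y + x \<bullet> y)"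
    using xy comm_scalar_prod[of y n x]
    by (simp add: add_scalar_prod_distrib[of x n y] scalar_prod_add_distrib[of _ n] algebra_simps)
  moreover have "x \<bullet> x = e * dot a a" "y \<bullet> y = e * dot b b"
    using sq by (simp_all add: x_def y_def)
  ultimately have "x \<bullet> y + x \<bullet> y = e * dot a b + e * dot a b"
    by (simp add: dot_add dot_commute[of b a] algebra_simps)
  then have "x \<bullet> y = e * dot a b" by (simp only: gf3_double neg_equal_iff_equal)
  then show ?thesis by (simp add: x_def y_def)
qed

definition gen_code :: "nat \<Rightarrow> (nat \<Rightarrow> point) \<Rightarrow> gf3 vec set" where
  "gen_code n g = range (codeword n g)"

lemma conformal_inj:
  assumes "conformal e (weight n g)"
  shows "inj (codeword n g)"
proof
  fix a b assume eq: "codeword n g a = codeword n g b"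
  have "dot (a - b) c = 0" for c
  proof -
    have "e * dot a c = e * dot b c"
      using eq conformal_scalar_prod[OF assms, of _ c] by metis
    then have "dot a c = dot b c" using conformalD(2)[OF assms] by simp
    then show ?thesis by (simp add: dot_diff)
  qed
  from dot_nondegenerate[OF this] show "a = b" by simp
qed

lemma card_gen_code: "conformal e (weight n g) \<Longrightarrow> card (gen_code n g) = 27"
  unfolding gen_code_def by (subst card_image) (auto simp: conformal_inj card_point)

text \<open>Dimensions of codes are handled through cardinalities from here on: dimension 3 means 27
  codewords.\<close>

lemma (in vectorspace) card_eq_power_dim:
  assumes "finite (carrier V)"
  shows "card (carrier V) = card (carrier K) ^ dim"
proof -
  have "fin_dim" unfolding fin_dim_def
    by (rule exI[of _ "carrier V"]) (use assms in_own_span[of "carrier V"] span_is_subset2[of "carrier V"] in auto)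
  then obtain B where B: "finite B" "basis B" using finite_basis_exists by blast
  then have sub: "B \<subseteq> carrier V" by (simp add: basis_def)
  have uni: "\<forall>v. v \<in> carrier V \<longrightarrow> (\<exists>!a. a \<in> B \<rightarrow>\<^sub>E carrier K \<and> lincomb a B = v)"
    using basis_criterion[OF B(1) sub] B(2) by blast
  have "bij_betw (\<lambda>a. lincomb a B) (B \<rightarrow>\<^sub>E carrier K) (carrier V)"
  proof (rule bij_betwI')
    have cl: "lincomb a B \<in> carrier V" if "a \<in> B \<rightarrow>\<^sub>E carrier K" for a
      using that sub B(1) by (intro lincomb_closed) (auto simp: PiE_def)
    show "lincomb a B = lincomb b B \<longleftrightarrow> a = b" if "a \<in> B \<rightarrow>\<^sub>E carrier K" "b \<in> B \<rightarrow>\<^sub>E carrier K" for a b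
      using uni cl[OF that(1)] that by metis
    show "lincomb a B \<in> carrier V" if "a \<in> B \<rightarrow>\<^sub>E carrier K" for a using cl that .
    show "\<exists>a\<in>B \<rightarrow>\<^sub>E carrier K. v = lincomb a B" if "v \<in> carrier V" for v using uni that by metis
  qed
  then have "card (carrier V) = card (B \<rightarrow>\<^sub>E carrier K)" by (simp add: bij_betw_same_card)
  also have "\<dots> = card (carrier K) ^ card B" using B(1) by (simp add: card_PiE)
  finally show ?thesis using dim_basis[OF B] by simp
qed

lemma finite_carrier_vec: "finite (carrier_vec n :: gf3 vec set)"
proof -
  have "carrier_vec n \<subseteq> vec n ` ({..<n} \<rightarrow>\<^sub>E (UNIV :: gf3 set))"
  proof
    fix v :: "gf3 vec" assume v: "v \<in> carrier_vec n"
    then have "v = vec n (restrict (($) v) {..<n})" by auto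
    then show "v \<in> vec n ` ({..<n} \<rightarrow>\<^sub>E UNIV)" by (metis imageI restrict_PiE_iff UNIV_I)
  qed
  then show ?thesis by (rule finite_subset) (simp add: finite_PiE)
qed

lemma card_subspace:
  assumes "VectorSpace.subspace class_ring C (module_vec TYPE(gf3) n)"
  shows "card C = 3 ^ vectorspace.dim class_ring ((module_vec TYPE(gf3) n)\<lparr>carrier := C\<rparr>)"
proof -
  interpret V: vectorspace "class_ring :: gf3 ring" "module_vec TYPE(gf3) n" by (rule vec_vs)
  interpret W: vectorspace "class_ring :: gf3 ring" "(module_vec TYPE(gf3) n)\<lparr>carrier := C\<rparr>"
    using assms by (rule V.subspace_is_vs)
  have "C \<subseteq> carrier_vec n"
    using assms by (auto simp: subspace_def submodule_def module_vec_simps)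
  then have "finite C" using finite_carrier_vec finite_subset by blast
  then show ?thesis using W.card_eq_power_dim by (simp add: class_ring_simps card_gf3)
qed

lemma subspace_vec_iff:
  "VectorSpace.subspace class_ring C (module_vec TYPE(gf3) n) \<longleftrightarrow>
     C \<subseteq> carrier_vec n \<and> 0\<^sub>v n \<in> C \<and> (\<forall>x\<in>C. \<forall>y\<in>C. x + y \<in> C) \<and> (\<forall>c. \<forall>x\<in>C. c \<cdot>\<^sub>v x \<in> C)"
  using vec_vs[of n, where ?'a = gf3] vec_module[of n, where ?'a = gf3]
  unfolding subspace_def submodule_def by (auto simp: module_vec_simps class_ring_simps)

lemma ternary_code_iff:
  "ternary_code n 3 C \<longleftrightarrow>
     C \<subseteq> carrier_vec n \<and> 0\<^sub>v n \<in> C \<and> (\<forall>x\<in>C. \<forall>y\<in>C. x + y \<in> C) \<and> (\<forall>c. \<forall>x\<in>C. c \<cdot>\<^sub>v x \<in> C)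
     \<and> card C = 27"
proof -
  have "card C = 27 \<longleftrightarrow> vectorspace.dim class_ring ((module_vec TYPE(gf3) n)\<lparr>carrier := C\<rparr>) = 3"
    if "VectorSpace.subspace class_ring C (module_vec TYPE(gf3) n)"
    using card_subspace[OF that] power_inject_exp[of "3 :: nat" _ 3] by simp
  then show ?thesis unfolding ternary_code_def using subspace_vec_iff[of C n] by blast
qed

section \<open>Orthogonal bases of LCD codes\<close>

definition nondegenerate_space :: "nat \<Rightarrow> gf3 vec set \<Rightarrow> bool" where
  "nondegenerate_space n D \<longleftrightarrow> D \<subseteq> carrier_vec n \<and> 0\<^sub>v n \<in> D \<and>
     (\<forall>x\<in>D. \<forall>y\<in>D. x + y \<in> D) \<and> (\<forall>c. \<forall>x\<in>D. c \<cdot>\<^sub>v x \<in> D) \<and>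
     (\<forall>x\<in>D. (\<forall>y\<in>D. x \<bullet> y = 0) \<longrightarrow> x = 0\<^sub>v n)"

lemma scalar_prod_add:
  fixes x :: "gf3 vec"
  assumes "x \<in> carrier_vec n" "y \<in> carrier_vec n" "z \<in> carrier_vec n"
  shows "(x + y) \<bullet> z = x \<bullet> z + y \<bullet> z" "z \<bullet> (x + y) = z \<bullet> x + z \<bullet> y"
  using assms add_scalar_prod_distrib[of x n y z] scalar_prod_add_distrib[of z n x y] by auto

lemma scalar_prod_smult:
  fixes x :: "gf3 vec"
  assumes "x \<in> carrier_vec n" "z \<in> carrier_vec n"
  shows "(c \<cdot>\<^sub>v x) \<bullet> z = c * (x \<bullet> z)" "z \<bullet> (c \<cdot>\<^sub>v x) = c * (z \<bullet> x)"
  using assms smult_scalar_prod_distrib[of x n z c] scalar_prod_smult_distrib[of z n x c] by auto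

text \<open>If all vectors were isotropic then, by polarization, the whole form would vanish.\<close>

lemma exists_anisotropic:
  assumes D: "nondegenerate_space n D" and x: "x \<in> D" "x \<noteq> 0\<^sub>v n"
  shows "\<exists>v\<in>D. v \<bullet> v \<noteq> 0"
proof (rule ccontr)
  assume "\<not> ?thesis"
  then have iso: "v \<bullet> v = 0" if "v \<in> D" for v using that by blast
  have "x \<bullet> y = 0" if y: "y \<in> D" for y
  proof -
    have car: "x \<in> carrier_vec n" "y \<in> carrier_vec n" "x + y \<in> D"
      using D x y by (auto simp: nondegenerate_space_def)
    have "0 = (x + y) \<bullet> (x + y)" using iso car(3) by simp
    also have "\<dots> = x \<bullet> x + y \<bullet> y + (x \<bullet> y + x \<bullet> y)"
      using car comm_scalar_prod[of y n x] by (simp add: scalar_prod_add[of _ n] scalar_prod_smult[of _ n])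
    finally show ?thesis using iso x y by (simp add: gf3_double)
  qed
  then show False using D x by (auto simp: nondegenerate_space_def)
qed

text \<open>The Gram-Schmidt step: subtract the projection onto the anisotropic vector.\<close>

lemma orthogonal_splitting:
  assumes D: "nondegenerate_space n D" and v: "v \<in> D" "v \<bullet> v \<noteq> 0" and y: "y \<in> D"
  shows "\<exists>c. \<exists>z\<in>{x \<in> D. x \<bullet> v = 0}. y = c \<cdot>\<^sub>v v + z"
proof -
  define c where "c = (y \<bullet> v) / (v \<bullet> v)"
  have car: "v \<in> carrier_vec n" "y \<in> carrier_vec n" using D v y by (auto simp: nondegenerate_space_def)
  have "y + (- c) \<cdot>\<^sub>v v \<in> D" using D v y by (auto simp: nondegenerate_space_def)
  moreover have "(y + (- c) \<cdot>\<^sub>v v) \<bullet> v = 0"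
    using car v(2) by (simp add: scalar_prod_add[of _ n] scalar_prod_smult[of _ n] c_def)
  moreover have "y = c \<cdot>\<^sub>v v + (y + (- c) \<cdot>\<^sub>v v)" using car by auto
  ultimately show ?thesis by blast
qed

text \<open>The cardinality estimate replaces a dimension count: it keeps the successive orthogonal complements
  in a code with 27 elements nonzero for two steps, so that three orthogonal vectors can be chosen.\<close>

lemma nondegenerate_complement:
  assumes D: "nondegenerate_space n D" and v: "v \<in> D" "v \<bullet> v \<noteq> 0"
  shows "nondegenerate_space n {x \<in> D. x \<bullet> v = 0}" (is "nondegenerate_space n ?E")
    and "card D \<le> 3 * card {x \<in> D. x \<bullet> v = 0}"
proof -
  have car: "x \<in> carrier_vec n" if "x \<in> D" for x using D that by (auto simp: nondegenerate_space_def)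
  have "x = 0\<^sub>v n" if x: "x \<in> ?E" and orth: "\<And>y. y \<in> ?E \<Longrightarrow> x \<bullet> y = 0" for x
  proof -
    have "x \<bullet> y = 0" if y: "y \<in> D" for y
    proof -
      obtain c z where z: "z \<in> ?E" "y = c \<cdot>\<^sub>v v + z" using orthogonal_splitting[OF D v y] by blast
      then show ?thesis using x orth[OF z(1)] car v by (simp add: scalar_prod_add[of _ n] scalar_prod_smult[of _ n])
    qed
    then show ?thesis using D x by (auto simp: nondegenerate_space_def)
  qed
  moreover have "0\<^sub>v n \<in> ?E" "\<forall>x\<in>?E. \<forall>y\<in>?E. x + y \<in> ?E" "\<forall>c. \<forall>x\<in>?E. c \<cdot>\<^sub>v x \<in> ?E" "?E \<subseteq> carrier_vec n"
    using D car v by (auto simp: nondegenerate_space_def scalar_prod_add[of _ n] scalar_prod_smult[of _ n])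
  ultimately show "nondegenerate_space n ?E" unfolding nondegenerate_space_def by blast
  have fin: "finite ?E" by (rule finite_subset[OF _ finite_carrier_vec[of n]]) (use car in auto)
  have "D \<subseteq> (\<lambda>(c, z). c \<cdot>\<^sub>v v + z) ` (UNIV \<times> ?E)"
    using orthogonal_splitting[OF D v] by fast
  then have "card D \<le> card ((UNIV :: gf3 set) \<times> ?E)"
    by (intro surj_card_le) (use fin in auto)
  then show "card D \<le> 3 * card ?E" by (simp add: card_cartesian_product card_gf3)
qed

lemma nonzero_of_card:
  assumes "nondegenerate_space n D" "card D > 1"
  shows "\<exists>x\<in>D. x \<noteq> 0\<^sub>v n"
proof (rule ccontr)
  assume "\<not> ?thesis"
  then have "D \<subseteq> {0\<^sub>v n}" by auto
  then have "card D \<le> 1" using card_mono[of "{0\<^sub>v n}" D] by simp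
  then show False using assms by simp
qed

definition orthogonal_frame :: "gf3 vec \<Rightarrow> gf3 vec \<Rightarrow> gf3 vec \<Rightarrow> bool" where
  "orthogonal_frame u v w \<longleftrightarrow> u \<bullet> v = 0 \<and> u \<bullet> w = 0 \<and> v \<bullet> w = 0"

lemma exists_orthogonal_frame:
  assumes C: "nondegenerate_space n C" "card C = 27"
  shows "\<exists>u\<in>C. \<exists>v\<in>C. \<exists>w\<in>C. orthogonal_frame u v w \<and> u \<bullet> u \<noteq> 0 \<and> v \<bullet> v \<noteq> 0 \<and> w \<bullet> w \<noteq> 0"
proof -
  obtain u where u: "u \<in> C" "u \<bullet> u \<noteq> 0"
    using exists_anisotropic[OF C(1)] nonzero_of_card[OF C(1)] C(2) by auto
  define D where "D = {x \<in> C. x \<bullet> u = 0}"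
  have D: "nondegenerate_space n D" "card C \<le> 3 * card D"
    using nondegenerate_complement[OF C(1) u] by (simp_all add: D_def)
  obtain v where v: "v \<in> D" "v \<bullet> v \<noteq> 0"
    using exists_anisotropic[OF D(1)] nonzero_of_card[OF D(1)] D(2) C(2) by auto
  define E where "E = {x \<in> D. x \<bullet> v = 0}"
  have E: "nondegenerate_space n E" "card D \<le> 3 * card E"
    using nondegenerate_complement[OF D(1) v] by (simp_all add: E_def)
  obtain w where w: "w \<in> E" "w \<bullet> w \<noteq> 0"
    using exists_anisotropic[OF E(1)] nonzero_of_card[OF E(1)] D(2) E(2) C(2) by auto
  have car: "x \<in> carrier_vec n" if "x \<in> C" for x using C(1) that by (auto simp: nondegenerate_space_def)
  have "orthogonal_frame u v w"
    using u v w car comm_scalar_prod[of u n v] comm_scalar_prod[of u n w] comm_scalar_prod[of v n w]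
    unfolding orthogonal_frame_def D_def E_def by simp
  then show ?thesis using u v w unfolding D_def E_def by blast
qed

lemma gf3_eq_uminus: "x \<noteq> 0 \<Longrightarrow> y \<noteq> 0 \<Longrightarrow> x \<noteq> y \<Longrightarrow> y = - x" for x y :: gf3
  by (cases x rule: gf3_cases; cases y rule: gf3_cases) auto

text \<open>If \<open>u\<close> and \<open>v\<close> are orthogonal of the same norm \<open>s\<close>, then \<open>u + v\<close> and \<open>u - v\<close> are orthogonal of norm
  \<open>2s = -s\<close>. Among three nonzero norms two agree, and if the third one is different, flipping the
  equal pair makes all three agree.\<close>

lemma equalize_norms:
  assumes C: "nondegenerate_space n C" and mem: "u \<in> C" "v \<in> C" "w \<in> C"
    and orth: "orthogonal_frame u v w" and nz: "u \<bullet> u \<noteq> 0" "w \<bullet> w \<noteq> 0" and eq: "u \<bullet> u = v \<bullet> v"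
  shows "\<exists>e u v w. e \<noteq> 0 \<and> u \<in> C \<and> v \<in> C \<and> w \<in> C \<and> orthogonal_frame u v w \<and>
           u \<bullet> u = e \<and> v \<bullet> v = e \<and> w \<bullet> w = e"
proof (cases "w \<bullet> w = u \<bullet> u")
  case True
  then show ?thesis using mem orth nz eq by metis
next
  case False
  have car: "u \<in> carrier_vec n" "v \<in> carrier_vec n" "w \<in> carrier_vec n"
    using C mem by (auto simp: nondegenerate_space_def)
  let ?x = "u + v" and ?y = "u + (-1) \<cdot>\<^sub>v v"
  have sw: "v \<bullet> u = 0" "w \<bullet> u = 0" "w \<bullet> v = 0" "u \<bullet> v = 0" "u \<bullet> w = 0" "v \<bullet> w = 0"
    using orth car comm_scalar_prod[of u n v] comm_scalar_prod[of u n w] comm_scalar_prod[of v n w]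
    unfolding orthogonal_frame_def by simp_all
  have "w \<bullet> w = - (u \<bullet> u)" using gf3_eq_uminus nz False by metis
  moreover have "?x \<bullet> ?x = - (u \<bullet> u)" "?y \<bullet> ?y = - (u \<bullet> u)" "orthogonal_frame ?x ?y w"
    using car sw eq by (simp_all add: orthogonal_frame_def scalar_prod_add[of _ n] scalar_prod_smult[of _ n] gf3_double)
  moreover have "?x \<in> C" "?y \<in> C" using C mem by (simp_all add: nondegenerate_space_def)
  ultimately show ?thesis using nz mem(3) by (intro exI[of _ "- (u \<bullet> u)"] exI[of _ ?x] exI[of _ ?y] exI[of _ w]) simp
qed

lemma exists_conformal_frame:
  assumes C: "nondegenerate_space n C" "card C = 27"
  shows "\<exists>e u v w. e \<noteq> 0 \<and> u \<in> C \<and> v \<in> C \<and> w \<in> C \<and> orthogonal_frame u v w \<and>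
           u \<bullet> u = e \<and> v \<bullet> v = e \<and> w \<bullet> w = e"
proof -
  obtain u v w where uvw: "u \<in> C" "v \<in> C" "w \<in> C" "orthogonal_frame u v w"
    "u \<bullet> u \<noteq> 0" "v \<bullet> v \<noteq> 0" "w \<bullet> w \<noteq> 0" using exists_orthogonal_frame[OF C] by blast
  have car: "u \<in> carrier_vec n" "v \<in> carrier_vec n" "w \<in> carrier_vec n"
    using C uvw by (auto simp: nondegenerate_space_def)
  have o: "orthogonal_frame u w v" "orthogonal_frame v w u"
    using uvw(4) car comm_scalar_prod[of u n v] comm_scalar_prod[of u n w] comm_scalar_prod[of v n w]
    unfolding orthogonal_frame_def by simp_all
  consider "u \<bullet> u = v \<bullet> v" | "u \<bullet> u = w \<bullet> w" | "v \<bullet> v = w \<bullet> w"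
    using gf3_eq_uminus uvw(5-7) by metis
  then show ?thesis
  proof cases
    case 1 show ?thesis by (rule equalize_norms[OF C(1) uvw(1,2,3,4,5,7) 1])
  next
    case 2 show ?thesis by (rule equalize_norms[OF C(1) uvw(1,3,2) o(1) uvw(5,6) 2])
  next
    case 3 show ?thesis by (rule equalize_norms[OF C(1) uvw(2,3,1) o(2) uvw(6,5) 3])
  qed
qed

lemma lcd_nondegenerate:
  assumes "ternary_code n 3 C" "lcd n C"
  shows "nondegenerate_space n C"
proof -
  have "x = 0\<^sub>v n" if "x \<in> C" "\<forall>y\<in>C. x \<bullet> y = 0" for x
    using that assms unfolding lcd_def dual_code_def ternary_code_iff by blast
  then show ?thesis using assms(1) unfolding nondegenerate_space_def ternary_code_iff by blast
qed

text \<open>The LCD property is nondegeneracy of the inner product on the code, so the code has an orthogonal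
  basis of constant norm; its coordinates are the columns of the required generator matrix.\<close>

lemma lcd_exists_generator:
  assumes "ternary_code n 3 C" "lcd n C"
  shows "\<exists>g e. C = gen_code n g \<and> conformal e (weight n g)"
proof -
  have C: "nondegenerate_space n C" "card C = 27"
    using lcd_nondegenerate[OF assms] assms(1) by (simp_all add: ternary_code_iff)
  obtain e u v w where e: "e \<noteq> 0" and mem: "u \<in> C" "v \<in> C" "w \<in> C" and orth: "orthogonal_frame u v w"
    and norms: "u \<bullet> u = e" "v \<bullet> v = e" "w \<bullet> w = e"
    using exists_conformal_frame[OF C] by blast
  have car: "u \<in> carrier_vec n" "v \<in> carrier_vec n" "w \<in> carrier_vec n"
    using C mem by (auto simp: nondegenerate_space_def)
  have sw: "v \<bullet> u = 0" "w \<bullet> u = 0" "w \<bullet> v = 0" "u \<bullet> v = 0" "u \<bullet> w = 0" "v \<bullet> w = 0"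
    using orth car comm_scalar_prod[of u n v] comm_scalar_prod[of u n w] comm_scalar_prod[of v n w]
    unfolding orthogonal_frame_def by simp_all
  define g where "g = (\<lambda>i. (u $ i, v $ i, w $ i))"
  have cw: "codeword n g (a, b, c) = a \<cdot>\<^sub>v u + (b \<cdot>\<^sub>v v + c \<cdot>\<^sub>v w)" for a b c
    using car by (auto simp: codeword_def g_def dot_def)
  have "of_nat (weight n g p) = e * dot p p" for p
  proof -
    obtain a b c where p: "p = (a, b, c)" by (cases p)
    have "of_nat (weight n g p) = codeword n g p \<bullet> codeword n g p"
      by (simp add: scalar_prod_self hamming_weight_codeword)
    also have "\<dots> = e * dot p p"
      unfolding p cw using car norms sw
      by (simp add: scalar_prod_add[of _ n] scalar_prod_smult[of _ n] dot_def algebra_simps)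
    finally show ?thesis .
  qed
  then have conf: "conformal e (weight n g)" using e unfolding conformal_def by blast
  have "codeword n g p \<in> C" for p
    by (cases p) (use C(1) mem in \<open>simp add: cw nondegenerate_space_def\<close>)
  then have "gen_code n g \<subseteq> C" by (auto simp: gen_code_def)
  moreover have "finite C" using C(2) card.infinite by force
  ultimately have "gen_code n g = C"
    using card_gen_code[OF conf] C(2) by (intro card_subset_eq) auto
  then show ?thesis using conf by blast
qed

lemma codeword_mem: "codeword n g a \<in> gen_code n g"
  by (simp add: gen_code_def)

lemma gen_code_lcd:
  assumes conf: "conformal e (weight n g)"
  shows "ternary_code n 3 (gen_code n g)" "lcd n (gen_code n g)"
proof -
  have "x + y \<in> gen_code n g" if mem: "x \<in> gen_code n g" "y \<in> gen_code n g" for x y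
  proof -
    obtain a b where "x = codeword n g a" "y = codeword n g b" using mem unfolding gen_code_def by blast
    then have "x + y = codeword n g (a + b)" by (simp add: codeword_add)
    then show ?thesis using codeword_mem by simp
  qed
  moreover have "c \<cdot>\<^sub>v x \<in> gen_code n g" if mem: "x \<in> gen_code n g" for c x
  proof -
    obtain a where "x = codeword n g a" using mem unfolding gen_code_def by blast
    then have "c \<cdot>\<^sub>v x = codeword n g (scale c a)" by (simp add: codeword_scale)
    then show ?thesis using codeword_mem by simp
  qed
  moreover have zero: "0\<^sub>v n \<in> gen_code n g" using codeword_mem[of n g 0] by simp
  moreover have "gen_code n g \<subseteq> carrier_vec n" by (auto simp: gen_code_def)
  ultimately show "ternary_code n 3 (gen_code n g)"
    unfolding ternary_code_iff using card_gen_code[OF conf] by blast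
  have "x = 0\<^sub>v n" if x: "x \<in> gen_code n g" "\<And>y. y \<in> gen_code n g \<Longrightarrow> x \<bullet> y = 0" for x
  proof -
    obtain a where a: "x = codeword n g a" using x(1) by (auto simp: gen_code_def)
    have "dot a b = 0" for b
      using x(2)[of "codeword n g b"] conformal_scalar_prod[OF conf, of a b] conformalD(2)[OF conf]
      by (simp add: gen_code_def a)
    then show ?thesis using dot_nondegenerate a by (metis codeword_0)
  qed
  then have "gen_code n g \<inter> dual_code n (gen_code n g) \<subseteq> {0\<^sub>v n}"
    unfolding dual_code_def by blast
  moreover have "0\<^sub>v n \<in> dual_code n (gen_code n g)"
    by (simp add: dual_code_def gen_code_def)
  ultimately show "lcd n (gen_code n g)" unfolding lcd_def using zero by blast
qed

section \<open>Minimum weight and dual distance\<close>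

lemma min_weight_gen_code:
  assumes conf: "conformal e (weight n g)"
  shows "min_weight (gen_code n g) = Min (weight n g ` (UNIV - {0}))"
proof -
  have "codeword n g a = 0\<^sub>v n \<longleftrightarrow> a = 0" for a
    using conformal_inj[OF conf] by (metis codeword_0 injD)
  then have "{c \<in> gen_code n g. c \<noteq> 0\<^sub>v (dim_vec c)} = codeword n g ` (UNIV - {0})"
    by (auto simp: gen_code_def)
  then show ?thesis
    unfolding min_weight_def by (simp add: image_image hamming_weight_codeword)
qed

lemma finite_point_set: "finite (A :: point set)"
  by (rule finite)

lemma min_weight_ge_iff:
  assumes "conformal e (weight n g)"
  shows "d \<le> min_weight (gen_code n g) \<longleftrightarrow> (\<forall>a. a \<noteq> 0 \<longrightarrow> d \<le> weight n g a)"
proof -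
  have "(1, 0, 0) \<in> UNIV - {0 :: point}" by (simp add: zero_prod_def)
  then have "UNIV - {0 :: point} \<noteq> {}" by blast
  then show ?thesis unfolding min_weight_gen_code[OF assms] by (subst Min_ge_iff) auto
qed

lemma codeword_scalar_prod:
  assumes "x \<in> carrier_vec n"
  shows "x \<bullet> codeword n g a =
    dot a (x \<bullet> codeword n g (1, 0, 0), x \<bullet> codeword n g (0, 1, 0), x \<bullet> codeword n g (0, 0, 1))"
  by (simp add: scalar_prod_def codeword_def dot_def sum.distrib sum_distrib_left algebra_simps)

lemma card_carrier_gf3: "card (carrier_vec n :: gf3 vec set) = 3 ^ n"
proof -
  interpret V: vec_space "TYPE(gf3)" n .
  show ?thesis using V.card_eq_power_dim finite_carrier_vec[of n] by (simp add: V.dim_is_n card_gf3)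
qed

text \<open>Pigeonhole: the three inner products with the rows of the generator matrix take at most 27 values
  on the \<open>3\<^sup>n > 27\<close> vectors.\<close>

lemma dual_code_nontrivial:
  assumes "n \<ge> 4"
  shows "\<exists>x\<in>dual_code n (gen_code n g). x \<noteq> 0\<^sub>v n"
proof -
  let ?f = "\<lambda>x. (x \<bullet> codeword n g (1, 0, 0), x \<bullet> codeword n g (0, 1, 0), x \<bullet> codeword n g (0, 0, 1))"
  have "(3 :: nat) ^ 4 \<le> 3 ^ n" using assms by (intro power_increasing) auto
  then have "card (?f ` carrier_vec n) < card (carrier_vec n :: gf3 vec set)"
    using card_mono[OF finite_point_set subset_UNIV, of "?f ` carrier_vec n"]
    by (simp add: card_carrier_gf3 card_point)
  then have "\<not> inj_on ?f (carrier_vec n)" by (rule pigeonhole)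
  then obtain x y where xy: "x \<in> carrier_vec n" "y \<in> carrier_vec n" "?f x = ?f y" "x \<noteq> y"
    unfolding inj_on_def by blast
  let ?z = "x + (-1) \<cdot>\<^sub>v y"
  have z: "?z \<in> carrier_vec n" using xy by simp
  have "?f ?z = 0" using xy by (simp add: scalar_prod_add[of _ n] scalar_prod_smult[of _ n] zero_prod_def)
  then have "?z \<bullet> codeword n g a = 0" for a
    using codeword_scalar_prod[OF z, of g a] by simp
  then have "?z \<in> dual_code n (gen_code n g)" using z by (auto simp: dual_code_def gen_code_def)
  moreover have "?z \<noteq> 0\<^sub>v n"
  proof
    assume 0: "?z = 0\<^sub>v n"
    have "x $ i = y $ i" if "i < n" for i
      using arg_cong[OF 0, of "\<lambda>v. v $ i"] that xy by simp
    then show False using xy by (metis carrier_vecD eq_vecI)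
  qed
  ultimately show ?thesis by blast
qed

text \<open>A dual word of weight 1 is supported on a single coordinate, at which every codeword vanishes.\<close>

lemma dual_distance_ge_2_iff:
  assumes "n \<ge> 4"
  shows "dual_distance n (gen_code n g) \<ge> 2 \<longleftrightarrow> (\<forall>i<n. g i \<noteq> 0)"
proof -
  let ?D = "{x \<in> dual_code n (gen_code n g). x \<noteq> 0\<^sub>v (dim_vec x)}"
  have D: "?D = {x \<in> dual_code n (gen_code n g). x \<noteq> 0\<^sub>v n}" by (auto simp: dual_code_def)
  have "finite ?D" by (rule finite_subset[OF _ finite_carrier_vec[of n]]) (auto simp: dual_code_def)
  moreover have "?D \<noteq> {}" using dual_code_nontrivial[OF assms] D by blast
  ultimately have ge: "dual_distance n (gen_code n g) \<ge> 2 \<longleftrightarrow> (\<forall>x\<in>?D. hamming_weight x \<ge> 2)"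
    unfolding dual_distance_def min_weight_def by (subst Min_ge_iff) auto
  show ?thesis
  proof
    assume "dual_distance n (gen_code n g) \<ge> 2"
    then have wt: "\<forall>x\<in>?D. hamming_weight x \<ge> 2" using ge by blast
    show "\<forall>i<n. g i \<noteq> 0"
    proof (intro allI impI notI)
      fix i assume i: "i < n" "g i = 0"
      have "unit_vec n i \<bullet> codeword n g a = 0" for a
        using i by (simp add: codeword_def)
      then have "unit_vec n i \<in> dual_code n (gen_code n g)" by (auto simp: dual_code_def gen_code_def)
      moreover have "unit_vec n i \<noteq> (0\<^sub>v n :: gf3 vec)" using i(1) by simp
      ultimately have "hamming_weight (unit_vec n i :: gf3 vec) \<ge> 2" using wt by auto
      moreover have "{j. j < n \<and> unit_vec n i $ j \<noteq> (0 :: gf3)} = {i}" using i(1) by (auto simp: unit_vec_def split: if_splits)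
      ultimately show False by (simp add: hamming_weight_def)
    qed
  next
    assume g: "\<forall>i<n. g i \<noteq> 0"
    have "hamming_weight x \<ge> 2" if x: "x \<in> ?D" for x
    proof (rule ccontr)
      assume "\<not> ?thesis"
      then have small: "card {i. i < dim_vec x \<and> x $ i \<noteq> 0} \<le> 1" by (simp add: hamming_weight_def)
      have car: "x \<in> carrier_vec n" "x \<noteq> 0\<^sub>v n" using x D by (auto simp: dual_code_def)
      obtain i where i: "i < n" "x $ i \<noteq> 0"
        using car by (metis carrier_vecD eq_vecI index_zero_vec)
      have only: "x $ j = 0" if "j < n" "j \<noteq> i" for j
      proof (rule ccontr)
        assume "x $ j \<noteq> 0"
        then have "{i, j} \<subseteq> {i. i < dim_vec x \<and> x $ i \<noteq> 0}" using i that car by auto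
        then have "card {i, j} \<le> 1" using small card_mono[of "{i. i < dim_vec x \<and> x $ i \<noteq> 0}" "{i, j}"] by simp
        then show False using that by simp
      qed
      have "dot (g i) a = 0" for a
      proof -
        have "0 = x \<bullet> codeword n g a" using x codeword_mem[of n g a] unfolding dual_code_def by simp
        also have "\<dots> = (\<Sum>j\<in>{0..<n}. if j = i then x $ i * dot a (g i) else 0)"
          unfolding scalar_prod_def using only by (intro sum.cong) (auto simp: codeword_def)
        also have "\<dots> = x $ i * dot a (g i)" using i by simp
        finally show ?thesis using i by (simp add: dot_commute)
      qed
      then have "g i = 0" by (rule dot_nondegenerate)
      then show False using g i by blast
    qed
    then show "dual_distance n (gen_code n g) \<ge> 2" using ge by blast
  qed
qed

section \<open>Monomial equivalence\<close>

text \<open>The action of the monomial matrix whose column \<open>j\<close> has its only nonzero entry \<open>c j\<close> in row \<open>\<pi> j\<close>.\<close>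

definition monomial_act :: "nat \<Rightarrow> (nat \<Rightarrow> nat) \<Rightarrow> (nat \<Rightarrow> gf3) \<Rightarrow> gf3 vec \<Rightarrow> gf3 vec" where
  "monomial_act n \<pi> c x = vec n (\<lambda>j. c j * x $ \<pi> j)"

lemma mult_single_column:
  assumes P: "P \<in> carrier_mat n n" and x: "x \<in> carrier_vec n"
    and pi: "\<And>j. j < n \<Longrightarrow> \<pi> j < n"
    and col: "\<And>i j. i < n \<Longrightarrow> j < n \<Longrightarrow> P $$ (i, j) = (if i = \<pi> j then c j else 0)"
  shows "transpose_mat P *\<^sub>v x = monomial_act n \<pi> c x"
proof (rule eq_vecI)
  fix j assume "j < dim_vec (monomial_act n \<pi> c x)"
  then have j: "j < n" by (simp add: monomial_act_def)
  have "(transpose_mat P *\<^sub>v x) $ j = (\<Sum>i\<in>{0..<n}. P $$ (i, j) * x $ i)"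
    using j P x by (simp add: scalar_prod_def)
  also have "\<dots> = (\<Sum>i\<in>{0..<n}. if i = \<pi> j then c j * x $ \<pi> j else 0)"
    using j by (intro sum.cong) (auto simp: col)
  finally show "(transpose_mat P *\<^sub>v x) $ j = monomial_act n \<pi> c x $ j"
    using j pi by (simp add: monomial_act_def)
qed (use P in \<open>simp add: monomial_act_def\<close>)

lemma equivalent_codes_iff:
  assumes C: "C \<subseteq> carrier_vec n"
  shows "equivalent_codes n C C' \<longleftrightarrow>
    (\<exists>\<pi> c. bij_betw \<pi> {..<n} {..<n} \<and> (\<forall>i<n. c i \<noteq> 0) \<and> C' = monomial_act n \<pi> c ` C)"
proof
  assume "equivalent_codes n C C'"
  then obtain P where P: "P \<in> carrier_mat n n"
    and row: "\<forall>i<n. \<exists>!j. j < n \<and> P $$ (i, j) \<noteq> 0"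
    and col: "\<forall>j<n. \<exists>!i. i < n \<and> P $$ (i, j) \<noteq> 0"
    and C': "C' = {transpose_mat P *\<^sub>v c | c. c \<in> C}"
    unfolding equivalent_codes_def monomial_mat_def by blast
  define \<pi> where "\<pi> = (\<lambda>j. THE i. i < n \<and> P $$ (i, j) \<noteq> 0)"
  have pi: "\<pi> j < n" "P $$ (\<pi> j, j) \<noteq> 0" if "j < n" for j
    using theI'[OF col[rule_format, OF that]] unfolding \<pi>_def by blast+
  have "inj_on \<pi> {..<n}"
  proof (rule inj_onI)
    fix j k assume "j \<in> {..<n}" "k \<in> {..<n}" "\<pi> j = \<pi> k"
    then show "j = k" using pi[of j] pi[of k] row by (metis lessThan_iff)
  qed
  then have "bij_betw \<pi> {..<n} {..<n}"
    using pi(1) by (intro bij_betw_imageI endo_inj_surj) auto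
  moreover have entry: "P $$ (i, j) = (if i = \<pi> j then P $$ (\<pi> j, j) else 0)" if "i < n" "j < n" for i j
    using col[rule_format, OF that(2)] pi[OF that(2)] that(1) by auto
  have "transpose_mat P *\<^sub>v x = monomial_act n \<pi> (\<lambda>j. P $$ (\<pi> j, j)) x" if "x \<in> C" for x
  proof (rule mult_single_column[OF P])
    show "x \<in> carrier_vec n" using C that by blast
  qed (fact pi(1), fact entry)
  then have "C' = monomial_act n \<pi> (\<lambda>j. P $$ (\<pi> j, j)) ` C"
    unfolding C' image_def by (auto intro!: exI)
  ultimately show "\<exists>\<pi> c. bij_betw \<pi> {..<n} {..<n} \<and> (\<forall>i<n. c i \<noteq> 0) \<and> C' = monomial_act n \<pi> c ` C"
    using pi(2) by (intro exI[of _ \<pi>] exI[of _ "\<lambda>j. P $$ (\<pi> j, j)"]) blast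
next
  assume "\<exists>\<pi> c. bij_betw \<pi> {..<n} {..<n} \<and> (\<forall>i<n. c i \<noteq> 0) \<and> C' = monomial_act n \<pi> c ` C"
  then obtain \<pi> c where bij: "bij_betw \<pi> {..<n} {..<n}" and c: "\<forall>i<n. c i \<noteq> 0"
    and C': "C' = monomial_act n \<pi> c ` C" by blast
  define P where "P = mat n n (\<lambda>(i, j). if i = \<pi> j then c j else 0)"
  have pi: "\<pi> j < n" if "j < n" for j using bij that by (auto simp: bij_betw_def)
  have surj: "\<exists>!j. j < n \<and> \<pi> j = i" if "i < n" for i
    using bij that unfolding bij_betw_def inj_on_def
    by (metis (no_types, lifting) imageE lessThan_iff)
  have entry: "P $$ (i, j) = (if i = \<pi> j then c j else 0)" if "i < n" "j < n" for i j
    using that by (simp add: P_def)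
  have "\<exists>!j. j < n \<and> P $$ (i, j) \<noteq> 0" if "i < n" for i
  proof -
    have "j < n \<and> P $$ (i, j) \<noteq> 0 \<longleftrightarrow> j < n \<and> \<pi> j = i" for j
      using entry[of i j] c that by (auto split: if_splits)
    then show ?thesis using surj[OF that] by simp
  qed
  moreover have "\<exists>!i. i < n \<and> P $$ (i, j) \<noteq> 0" if "j < n" for j
  proof -
    have "i < n \<and> P $$ (i, j) \<noteq> 0 \<longleftrightarrow> i = \<pi> j" for i
      using entry[of i j] c that pi[OF that] by (auto split: if_splits)
    then show ?thesis by simp
  qed
  ultimately have "monomial_mat n P" by (simp add: monomial_mat_def P_def)
  moreover have "transpose_mat P *\<^sub>v x = monomial_act n \<pi> c x" if "x \<in> C" for x
    by (rule mult_single_column) (use C that pi entry in \<open>auto simp: P_def\<close>)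
  then have "C' = {transpose_mat P *\<^sub>v x | x. x \<in> C}" unfolding C' image_def by (auto intro!: exI)
  ultimately show "equivalent_codes n C C'" unfolding equivalent_codes_def by blast
qed

lemma monomial_act_gen_code:
  assumes "bij_betw \<pi> {..<n} {..<n}"
  shows "monomial_act n \<pi> c ` gen_code n g = gen_code n (\<lambda>j. scale (c j) (g (\<pi> j)))"
proof -
  have "\<pi> j < n" if "j < n" for j using assms that by (auto simp: bij_betw_def)
  then have "monomial_act n \<pi> c (codeword n g a) = codeword n (\<lambda>j. scale (c j) (g (\<pi> j))) a" for a
    by (auto simp: monomial_act_def codeword_def dot_scale)
  then show ?thesis by (simp add: gen_code_def image_image)
qed

lemma weight_monomial:
  assumes "bij_betw \<pi> {..<n} {..<n}" "\<forall>i<n. c i \<noteq> 0"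
  shows "weight n (\<lambda>j. scale (c j) (g (\<pi> j))) = weight n g"
proof
  fix a
  have "bij_betw \<pi> {j. j < n \<and> dot a (g (\<pi> j)) \<noteq> 0} {i. i < n \<and> dot a (g i) \<noteq> 0}"
    using assms(1) unfolding bij_betw_def by (auto intro: inj_on_subset)
  moreover have "{j. j < n \<and> dot a (scale (c j) (g (\<pi> j))) \<noteq> 0} = {j. j < n \<and> dot a (g (\<pi> j)) \<noteq> 0}"
    using assms(2) by (auto simp: dot_scale)
  ultimately show "weight n (\<lambda>j. scale (c j) (g (\<pi> j))) a = weight n g a"
    unfolding weight_def by (simp add: bij_betw_same_card)
qed

text \<open>The complete invariant of a code: the weights of its codewords, indexed by coordinates with respect
  to an orthogonal basis of constant norm, for all such bases at once.\<close>

definition weight_functions :: "nat \<Rightarrow> gf3 vec set \<Rightarrow> (point \<Rightarrow> nat) set" where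
  "weight_functions n C = {weight n g | g. C = gen_code n g \<and> (\<exists>e. conformal e (weight n g))}"

lemma weight_functions_monomial_subset:
  assumes "bij_betw \<pi> {..<n} {..<n}" "\<forall>i<n. c i \<noteq> 0"
  shows "weight_functions n C \<subseteq> weight_functions n (monomial_act n \<pi> c ` C)"
proof
  fix W assume "W \<in> weight_functions n C"
  then obtain g where g: "W = weight n g" "C = gen_code n g" "\<exists>e. conformal e W"
    unfolding weight_functions_def by blast
  then show "W \<in> weight_functions n (monomial_act n \<pi> c ` C)"
    using weight_monomial[OF assms, of g] monomial_act_gen_code[OF assms(1), of c g]
    unfolding weight_functions_def by (metis (mono_tags, lifting) mem_Collect_eq)
qed

lemma monomial_act_inverse:
  assumes bij: "bij_betw \<pi> {..<n} {..<n}" and c: "\<forall>i<n. c i \<noteq> 0" and C: "C \<subseteq> carrier_vec n"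
  shows "\<exists>\<rho> d. bij_betw \<rho> {..<n} {..<n} \<and> (\<forall>i<n. d i \<noteq> 0) \<and> monomial_act n \<rho> d ` (monomial_act n \<pi> c ` C) = C"
proof -
  define \<rho> where "\<rho> = inv_into {..<n} \<pi>"
  have rho: "bij_betw \<rho> {..<n} {..<n}" unfolding \<rho>_def by (rule bij_betw_inv_into[OF bij])
  have lt: "\<rho> j < n" "\<pi> (\<rho> j) = j" if "j < n" for j
    using rho that bij_betw_inv_into_right[OF bij] by (auto simp: bij_betw_def \<rho>_def)
  have sq: "c (\<rho> j) * (c (\<rho> j) * y) = y" if "j < n" for j y
    using c lt(1)[OF that] by (simp add: gf3_square flip: mult.assoc)
  have "monomial_act n \<rho> (\<lambda>j. c (\<rho> j)) (monomial_act n \<pi> c x) = x" if "x \<in> C" for x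
    using that C lt sq by (intro eq_vecI) (auto simp: monomial_act_def)
  then have "monomial_act n \<rho> (\<lambda>j. c (\<rho> j)) ` (monomial_act n \<pi> c ` C) = C"
    by (simp add: image_image)
  moreover have "\<forall>j<n. c (\<rho> j) \<noteq> 0" using c lt(1) by simp
  ultimately show ?thesis using rho by (intro exI conjI)
qed

lemma equivalent_weight_functions:
  assumes C: "C \<subseteq> carrier_vec n" and eq: "equivalent_codes n C C'"
  shows "weight_functions n C = weight_functions n C'"
proof -
  obtain \<pi> c where m: "bij_betw \<pi> {..<n} {..<n}" "\<forall>i<n. c i \<noteq> 0" "C' = monomial_act n \<pi> c ` C"
    using eq equivalent_codes_iff[OF C] by blast
  obtain \<rho> d where r: "bij_betw \<rho> {..<n} {..<n}" "\<forall>i<n. d i \<noteq> 0" "monomial_act n \<rho> d ` C' = C"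
    using monomial_act_inverse[OF m(1,2) C] m(3) by blast
  have "weight_functions n C \<subseteq> weight_functions n C'"
    using weight_functions_monomial_subset[OF m(1,2), of C] by (simp only: m(3))
  moreover have "weight_functions n C' \<subseteq> weight_functions n C"
    using weight_functions_monomial_subset[OF r(1,2), of C'] by (simp only: r(3))
  ultimately show ?thesis by (rule subset_antisym)
qed

text \<open>Given as the length of a filtered enumeration so that it can be evaluated for all pairs of points.
  Of the 27 vectors, 18 lie off the hyperplane orthogonal to \<open>p\<close>, and 12 of these lie off a second
  such hyperplane as well.\<close>

definition common_support :: "point \<Rightarrow> point \<Rightarrow> nat" where
  "common_support p q = length (filter (\<lambda>a. dot a p \<noteq> 0 \<and> dot a q \<noteq> 0) enum_class.enum)"

lemma common_support_value:
  "common_support p q = (if p = 0 \<or> q = 0 then 0 else if q = p \<or> q = - p then 18 else 12)"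
proof -
  have "\<forall>p q. common_support p q = (if p = 0 \<or> q = 0 then 0 else if q = p \<or> q = - p then 18 else 12)"
    by code_simp
  then show ?thesis by blast
qed

section \<open>The weight function determines the columns\<close>

lemma weight_sum: "weight n g a = (\<Sum>i<n. if dot a (g i) \<noteq> 0 then 1 else 0)"
  by (simp add: weight_def sum.If_cases lessThan_def Collect_conj_eq)

lemma common_support_sum:
  "common_support p q = (\<Sum>a\<in>UNIV. if dot a p \<noteq> 0 \<and> dot a q \<noteq> 0 then 1 else 0)"
proof -
  have "common_support p q = card (set (filter (\<lambda>a. dot a p \<noteq> 0 \<and> dot a q \<noteq> 0) enum_class.enum))"
    unfolding common_support_def by (rule distinct_card[symmetric]) (simp add: enum_distinct)
  also have "\<dots> = card {a. dot a p \<noteq> 0 \<and> dot a q \<noteq> 0}" by (simp add: enum_UNIV)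
  also have "\<dots> = (\<Sum>a\<in>UNIV. if dot a p \<noteq> 0 \<and> dot a q \<noteq> 0 then 1 else 0)"
    by (simp add: sum.If_cases[OF finite_point_set])
  finally show ?thesis .
qed

lemma card_not_orthogonal:
  "(\<Sum>a\<in>UNIV. if dot a q \<noteq> 0 then 1 else (0 :: nat)) = (if q = 0 then 0 else 18)"
  using common_support_sum[of q q] common_support_value[of q q] by (cases "q = 0") simp_all

definition line_multiplicity :: "nat \<Rightarrow> (nat \<Rightarrow> point) \<Rightarrow> point \<Rightarrow> nat" where
  "line_multiplicity n g p = card {i. i < n \<and> (g i = p \<or> g i = - p)}"

definition nonzero_columns :: "nat \<Rightarrow> (nat \<Rightarrow> point) \<Rightarrow> nat" where
  "nonzero_columns n g = card {i. i < n \<and> g i \<noteq> 0}"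

lemma sum_weight: "(\<Sum>a\<in>UNIV. weight n g a) = 18 * nonzero_columns n g"
proof -
  have "(\<Sum>a\<in>UNIV. weight n g a) = (\<Sum>i<n. \<Sum>a\<in>UNIV. if dot a (g i) \<noteq> 0 then 1 else 0)"
    unfolding weight_sum by (rule sum.swap)
  also have "\<dots> = (\<Sum>i<n. if g i \<noteq> 0 then 18 else 0)"
    unfolding card_not_orthogonal by (rule sum.cong) auto
  also have "\<dots> = 18 * nonzero_columns n g"
    by (simp add: nonzero_columns_def sum.If_cases lessThan_def Collect_conj_eq)
  finally show ?thesis .
qed

text \<open>Double counting: a column on the line of \<open>p\<close> contributes 18, any other nonzero column 12. Hence the
  weights determine how many columns lie on each line.\<close>

lemma sum_weight_off_hyperplane:
  assumes "p \<noteq> 0"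
  shows "(\<Sum>a\<in>UNIV. if dot a p \<noteq> 0 then weight n g a else 0)
           = 12 * nonzero_columns n g + 6 * line_multiplicity n g p"
proof -
  have "(\<Sum>a\<in>UNIV. if dot a p \<noteq> 0 then weight n g a else 0)
      = (\<Sum>a\<in>UNIV. \<Sum>i<n. if dot a p \<noteq> 0 \<and> dot a (g i) \<noteq> 0 then 1 else 0)"
    unfolding weight_sum by (rule sum.cong) auto
  also have "\<dots> = (\<Sum>i<n. common_support p (g i))"
    unfolding common_support_sum by (rule sum.swap)
  also have "\<dots> = (\<Sum>i<n. (if g i \<noteq> 0 then 12 else 0) + (if g i = p \<or> g i = - p then 6 else 0))"
    using assms by (intro sum.cong) (auto simp: common_support_value)
  also have "\<dots> = 12 * nonzero_columns n g + 6 * line_multiplicity n g p"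
    by (simp add: sum.distrib nonzero_columns_def line_multiplicity_def sum.If_cases lessThan_def Collect_conj_eq)
  finally show ?thesis .
qed

text \<open>Both column families meet every line equally often, so a permutation matches the lines, and
  two generators of a line differ by a nonzero factor.\<close>

lemma same_weights_monomial:
  assumes eq: "weight n g = weight n h"
  shows "\<exists>\<pi> c. bij_betw \<pi> {..<n} {..<n} \<and> (\<forall>i<n. c i \<noteq> 0) \<and> (\<forall>i<n. h i = scale (c i) (g (\<pi> i)))"
proof -
  have N: "nonzero_columns n g = nonzero_columns n h"
    using sum_weight[of n g] sum_weight[of n h] eq by simp
  have mult: "line_multiplicity n g p = line_multiplicity n h p" for p
  proof (cases "p = 0")
    case True
    have "line_multiplicity n f 0 = n - nonzero_columns n f" for f
    proof -
      have "{i. i < n \<and> f i = 0} = {..<n} - {i. i < n \<and> f i \<noteq> 0}" by auto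
      then have "card {i. i < n \<and> f i = 0} = card {..<n} - card {i. i < n \<and> f i \<noteq> 0}"
        by (simp only:) (rule card_Diff_subset, auto)
      then show ?thesis by (simp add: line_multiplicity_def nonzero_columns_def)
    qed
    then show ?thesis using True N by simp
  next
    case False
    then show ?thesis
      using sum_weight_off_hyperplane[OF False, of n g, unfolded eq N] sum_weight_off_hyperplane[OF False, of n h] by simp
  qed
  define line where "line = (\<lambda>p :: point. {p, - p})"
  have line_eq: "line q = line p \<longleftrightarrow> q = p \<or> q = - p" for p q
    unfolding line_def by (auto simp: doubleton_eq_iff)
  have count: "count (image_mset (\<lambda>i. line (f i)) (mset_set {..<n})) X = card {i. i < n \<and> line (f i) = X}" for f X
  proof -
    have "{i \<in> {..<n}. line (f i) = X} = {i. i < n \<and> line (f i) = X}" by auto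
    then show ?thesis
      by (simp add: count_image_mset' eq_commute[of X] flip: sum.inter_filter)
  qed
  have "card {i. i < n \<and> line (g i) = X} = card {i. i < n \<and> line (h i) = X}" for X
  proof (cases "\<exists>p. X = line p")
    case True
    then show ?thesis using mult by (auto simp: line_eq line_multiplicity_def)
  next
    case False
    then have "{i. i < n \<and> line (g i) = X} = {}" "{i. i < n \<and> line (h i) = X} = {}" by blast+
    then show ?thesis by (simp only:)
  qed
  then have "image_mset (\<lambda>i. line (h i)) (mset_set {..<n}) = image_mset (\<lambda>i. line (g i)) (mset_set {..<n})"
    by (intro multiset_eqI) (simp only: count)
  then obtain \<pi> where perm: "\<pi> permutes {..<n}" and pi: "\<forall>i\<in>{..<n}. line (h i) = line (g (\<pi> i))"
    by (rule image_mset_eq_implies_permutes[OF finite_lessThan])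
  define c where "c = (\<lambda>i. if h i = g (\<pi> i) then 1 else (-1 :: gf3))"
  have "h i = scale (c i) (g (\<pi> i))" if "i < n" for i
    using pi that by (auto simp: line_eq c_def scale_def prod_eq_iff)
  moreover have "bij_betw \<pi> {..<n} {..<n}" using perm by (rule permutes_imp_bij)
  moreover have "\<forall>i<n. c i \<noteq> 0" by (simp add: c_def)
  ultimately show ?thesis by blast
qed

lemma same_weights_equivalent:
  assumes "weight n g = weight n h"
  shows "equivalent_codes n (gen_code n g) (gen_code n h)"
proof -
  obtain \<pi> c where m: "bij_betw \<pi> {..<n} {..<n}" "\<forall>i<n. c i \<noteq> 0" "\<forall>i<n. h i = scale (c i) (g (\<pi> i))"
    using same_weights_monomial[OF assms] by blast
  have "codeword n h a = codeword n (\<lambda>j. scale (c j) (g (\<pi> j))) a" for a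
    using m(3) by (auto simp: codeword_def)
  then have img: "gen_code n h = monomial_act n \<pi> c ` gen_code n g"
    unfolding monomial_act_gen_code[OF m(1)] by (simp add: gen_code_def)
  have sub: "gen_code n g \<subseteq> carrier_vec n" by (auto simp: gen_code_def)
  show ?thesis
    unfolding equivalent_codes_iff[OF sub]
    using m(1,2) img by (intro exI conjI)
qed

lemma equivalent_iff_weight_functions:
  assumes C: "C \<subseteq> carrier_vec n" and W: "W \<in> weight_functions n C"
  shows "equivalent_codes n C C' \<longleftrightarrow> weight_functions n C = weight_functions n C'"
proof
  assume "weight_functions n C = weight_functions n C'"
  then obtain g h where "C = gen_code n g" "C' = gen_code n h" "weight n g = weight n h"
    using W unfolding weight_functions_def by blast
  then show "equivalent_codes n C C'" by (simp add: same_weights_equivalent)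
qed (rule equivalent_weight_functions[OF C])

section \<open>The orthogonal group acting on weight functions\<close>

definition act :: "point \<times> point \<times> point \<Rightarrow> point \<Rightarrow> point" where
  "act F a = scale (fst a) (fst F) + scale (fst (snd a)) (fst (snd F)) + scale (snd (snd a)) (snd (snd F))"

text \<open>The rows of orthogonal \<open>3 \<times> 3\<close> matrices.\<close>

definition orthonormal_frames :: "(point \<times> point \<times> point) set" where
  "orthonormal_frames = {(u, v, w). dot u u = 1 \<and> dot v v = 1 \<and> dot w w = 1 \<and>
     dot u v = 0 \<and> dot u w = 0 \<and> dot v w = 0}"

definition orbit :: "(point \<Rightarrow> nat) \<Rightarrow> (point \<Rightarrow> nat) set" where
  "orbit W = (\<lambda>F. W \<circ> act F) ` orthonormal_frames"

lemma dot_act: "dot (act (u, v, w) a) p = dot a (dot u p, dot v p, dot w p)"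
  by (simp add: act_def dot_add dot_scale dot_def[of a "(_, _, _)"])

lemma act_isometry:
  assumes "F \<in> orthonormal_frames"
  shows "dot (act F a) (act F b) = dot a b"
proof -
  obtain u v w where F: "F = (u, v, w)" by (cases F)
  have o: "dot u u = 1" "dot v v = 1" "dot w w = 1" "dot u v = 0" "dot u w = 0" "dot v w = 0"
    "dot v u = 0" "dot w u = 0" "dot w v = 0"
    using assms by (simp_all add: F orthonormal_frames_def dot_commute)
  show ?thesis
    unfolding F dot_act by (simp add: act_def dot_add dot_scale o dot_def[of a b])
qed

lemma det3_square_eq_gram:
  fixes u1 :: "'a :: comm_ring_1"
  assumes "D = u1 * (v2 * w3 - v3 * w2) - u2 * (v1 * w3 - v3 * w1) + u3 * (v1 * w2 - v2 * w1)"
    "uu = u1 * u1 + u2 * u2 + u3 * u3" "vv = v1 * v1 + v2 * v2 + v3 * v3" "ww = w1 * w1 + w2 * w2 + w3 * w3"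
    "uv = u1 * v1 + u2 * v2 + u3 * v3" "uw = u1 * w1 + u2 * w2 + u3 * w3" "vw = v1 * w1 + v2 * w2 + v3 * w3"
  shows "D * D = uu * (vv * ww - vw * vw) - uv * (uv * ww - vw * uw) + uw * (uv * vw - vv * uw)"
  unfolding assms by (simp add: algebra_simps)

text \<open>The determinant squared is the Gram determinant, which would be -1, a nonsquare. Consequently the
  constant norm \<open>e\<close> of an orthogonal basis is an invariant of the code.\<close>

lemma no_anti_orthonormal_frame:
  assumes "dot u v = 0" "dot u w = 0" "dot v w = 0"
  shows "\<not> (dot u u = -1 \<and> dot v v = -1 \<and> dot w w = -1)"
proof -
  obtain u1 u2 u3 where u: "u = (u1, u2, u3)" by (cases u)
  obtain v1 v2 v3 where v: "v = (v1, v2, v3)" by (cases v)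
  obtain w1 w2 w3 where w: "w = (w1, w2, w3)" by (cases w)
  define D where "D = u1 * (v2 * w3 - v3 * w2) - u2 * (v1 * w3 - v3 * w1) + u3 * (v1 * w2 - v2 * w1)"
  have "D * D = dot u u * (dot v v * dot w w - dot v w * dot v w)
      - dot u v * (dot u v * dot w w - dot v w * dot u w)
      + dot u w * (dot u v * dot v w - dot v v * dot u w)"
    unfolding D_def u v w dot_def fst_conv snd_conv by (rule det3_square_eq_gram) (rule refl)+
  then show ?thesis using assms by (auto simp: gf3_square gf3_minus_one split: if_splits)
qed

lemma weight_act_in_weight_functions:
  assumes conf: "conformal e (weight n g)" and F: "F \<in> orthonormal_frames"
  shows "weight n g \<circ> act F \<in> weight_functions n (gen_code n g)"
proof -
  obtain u v w where uvw: "F = (u, v, w)" by (cases F)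
  define h where "h = (\<lambda>i. (dot u (g i), dot v (g i), dot w (g i)))"
  have cw: "codeword n h a = codeword n g (act F a)" for a
    by (simp add: codeword_def h_def uvw dot_act)
  have wt: "weight n h = weight n g \<circ> act F"
    by (rule ext) (simp add: cw flip: hamming_weight_codeword)
  have "of_nat (weight n h a) = e * dot a a" for a
    using conformalD(1)[OF conf, of "act F a"] by (simp add: wt act_isometry[OF F])
  then have conf': "conformal e (weight n h)" using conformalD(2)[OF conf] unfolding conformal_def by blast
  have "gen_code n h \<subseteq> gen_code n g" by (auto simp: gen_code_def cw)
  then have "gen_code n h = gen_code n g"
    using card_gen_code[OF conf] card_gen_code[OF conf']
    by (intro card_subset_eq) (auto intro: card_ge_0_finite)
  then show "weight n g \<circ> act F \<in> weight_functions n (gen_code n g)"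
    using conf' wt unfolding weight_functions_def by (metis (mono_tags, lifting) mem_Collect_eq)
qed

text \<open>The rows of the second generator matrix are codewords of the first; their coordinates form an
  orthonormal frame because the Gram matrices are both multiples of the identity.\<close>

lemma conformal_generators_related:
  assumes g: "conformal e (weight n g)" and h: "conformal e' (weight n h)"
    and eq: "gen_code n g = gen_code n h"
  shows "\<exists>F\<in>orthonormal_frames. weight n h = weight n g \<circ> act F"
proof -
  have ex: "\<exists>u. codeword n h a = codeword n g u" for a
    using codeword_mem[of n h a] eq unfolding gen_code_def by blast
  obtain u where u: "codeword n h (1, 0, 0) = codeword n g u" using ex by blast
  obtain v where v: "codeword n h (0, 1, 0) = codeword n g v" using ex by blast
  obtain w where w: "codeword n h (0, 0, 1) = codeword n g w" using ex by blast
  have cw: "codeword n h a = codeword n g (act (u, v, w) a)" for a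
  proof -
    have "a = act ((1, 0, 0), (0, 1, 0), (0, 0, 1)) a"
      by (simp add: act_def scale_def prod_eq_iff)
    then have "codeword n h a = codeword n h (act ((1, 0, 0), (0, 1, 0), (0, 0, 1)) a)" by simp
    also have "\<dots> = codeword n g (act (u, v, w) a)"
      by (simp add: act_def codeword_add codeword_scale u v w)
    finally show ?thesis .
  qed
  have inner: "e * dot (act (u, v, w) a) (act (u, v, w) b) = e' * dot a b" for a b
    using conformal_scalar_prod[OF g, of "act (u, v, w) a" "act (u, v, w) b"]
      conformal_scalar_prod[OF h, of a b] by (simp add: cw)
  have act: "act (u, v, w) (1, 0, 0) = u" "act (u, v, w) (0, 1, 0) = v" "act (u, v, w) (0, 0, 1) = w"
    by (simp_all add: act_def scale_def prod_eq_iff)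
  have gram: "e * dot u u = e'" "e * dot v v = e'" "e * dot w w = e'"
    "e * dot u v = 0" "e * dot u w = 0" "e * dot v w = 0"
    using inner[of "(1, 0, 0)" "(1, 0, 0)"] inner[of "(0, 1, 0)" "(0, 1, 0)"] inner[of "(0, 0, 1)" "(0, 0, 1)"]
      inner[of "(1, 0, 0)" "(0, 1, 0)"] inner[of "(1, 0, 0)" "(0, 0, 1)"] inner[of "(0, 1, 0)" "(0, 0, 1)"]
    unfolding act by (simp_all add: dot_def)
  have e: "e \<noteq> 0" "e' \<noteq> 0" using g h by (simp_all add: conformalD(2))
  \<comment> \<open>Otherwise the coordinates would form a frame of norm -1.\<close>
  have "e' = e"
  proof (rule ccontr)
    assume "e' \<noteq> e"
    then have "e' = - e" using gf3_eq_uminus[of e e'] e by auto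
    then have "dot u u = -1" "dot v v = -1" "dot w w = -1"
      using gram(1-3) e(1) by (metis mult_cancel_left mult_minus1_right)+
    moreover have "dot u v = 0" "dot u w = 0" "dot v w = 0" using gram(4-6) e(1) by simp_all
    ultimately show False using no_anti_orthonormal_frame by blast
  qed
  then have "(u, v, w) \<in> orthonormal_frames" using gram e by (simp add: orthonormal_frames_def)
  moreover have "weight n h = weight n g \<circ> act (u, v, w)"
    by (rule ext) (simp add: cw flip: hamming_weight_codeword)
  ultimately show ?thesis by blast
qed

lemma weight_functions_gen_code:
  assumes conf: "conformal e (weight n g)"
  shows "weight_functions n (gen_code n g) = orbit (weight n g)"
proof
  show "weight_functions n (gen_code n g) \<subseteq> orbit (weight n g)"
    using conformal_generators_related[OF conf] unfolding weight_functions_def orbit_def by fast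
  show "orbit (weight n g) \<subseteq> weight_functions n (gen_code n g)"
    using weight_act_in_weight_functions[OF conf] unfolding orbit_def by blast
qed

section \<open>Residues of weights modulo three\<close>

text \<open>One representative of each of the 13 lines.\<close>

definition points :: "point list" where
  "points = [(0, 0, 1), (0, 1, 0), (0, 1, 1), (0, 1, -1), (1, 0, 0), (1, 0, 1), (1, 0, -1),
     (1, 1, 0), (1, 1, 1), (1, 1, -1), (1, -1, 0), (1, -1, 1), (1, -1, -1)]"

lemma length_points [simp]: "length points = 13" by (simp add: points_def)

lemma distinct_points: "distinct points" by code_simp

lemma points_cover:
  "a = 0 \<or> a \<in> set points \<or> - a \<in> set points" "0 \<notin> set points"
  "a \<in> set points \<Longrightarrow> - a \<notin> set points"
proof -
  have "list_all (\<lambda>a. a = 0 \<or> List.member points a \<or> List.member points (- a)) enum_class.enum \<and>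
    \<not> List.member points 0 \<and> list_all (\<lambda>a. \<not> List.member points (- a)) points" by code_simp
  then have *: "(\<forall>a. a = 0 \<or> a \<in> set points \<or> - a \<in> set points) \<and> 0 \<notin> set points \<and>
    (\<forall>a\<in>set points. - a \<notin> set points)" by (simp add: list_all_iff enum_UNIV del: split_paired_All)
  show "a = 0 \<or> a \<in> set points \<or> - a \<in> set points" "0 \<notin> set points"
    "a \<in> set points \<Longrightarrow> - a \<notin> set points" using * by blast+
qed

lemma sum_even:
  fixes h :: "point \<Rightarrow> nat"
  assumes "h 0 = 0" "\<And>a. h (- a) = h a"
  shows "(\<Sum>a\<in>UNIV. h a) = 2 * (\<Sum>a\<in>set points. h a)"
proof -
  have U: "(UNIV :: point set) = {0} \<union> (set points \<union> uminus ` set points)"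
    using points_cover(1) by (metis (no_types, lifting) UNIV_eq_I UnI1 UnI2 image_eqI insertI1 minus_minus)
  have "(\<Sum>a\<in>UNIV. h a) = h 0 + ((\<Sum>a\<in>set points. h a) + (\<Sum>a\<in>uminus ` set points. h a))"
  proof -
    have "{0} \<inter> (set points \<union> uminus ` set points) = {}"
      using points_cover(2) by (metis (no_types, lifting) Int_emptyI UnE imageE neg_0_equal_iff_equal singletonD)
    moreover have "set points \<inter> uminus ` set points = {}" using points_cover(3) by blast
    ultimately show ?thesis unfolding U by (simp add: sum.union_disjoint)
  qed
  also have "(\<Sum>a\<in>uminus ` set points. h a) = (\<Sum>a\<in>set points. h a)"
    by (subst sum.reindex) (auto simp: inj_on_def assms(2))
  finally show ?thesis using assms(1) by simp
qed

definition residue :: "gf3 \<Rightarrow> nat" where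
  "residue x = (if x = 0 then 0 else if x = 1 then 1 else 2)"

lemma of_nat_residue: "of_nat (residue x) = x" and residue_less: "residue x < 3"
  by (cases x rule: gf3_cases; simp add: residue_def gf3_minus_one gf3_numeral)+

lemma of_nat_gf3_eq: "of_nat m = (of_nat k :: gf3) \<longleftrightarrow> m mod 3 = k mod 3"
proof -
  have m: "of_nat m = (of_nat (m mod 3) :: gf3)" for m
  proof -
    have "(of_nat m :: gf3) = of_nat (3 * (m div 3) + m mod 3)" by simp
    also have "\<dots> = of_nat (m mod 3)" unfolding of_nat_add of_nat_mult by (simp add: gf3_numeral)
    finally show ?thesis .
  qed
  have "a = b" if "of_nat a = (of_nat b :: gf3)" "a < 3" "b < 3" for a b :: nat
  proof -
    have "a \<in> {0, 1, 2}" "b \<in> {0, 1, 2}" using that by auto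
    then show ?thesis using that(1) by (auto simp: gf3_minus_one gf3_numeral)
  qed
  from this[of "m mod 3" "k mod 3"] show ?thesis using m[of m] m[of k] by auto
qed

text \<open>The weight of the codeword at \<open>a\<close> is prescribed modulo 3, so a weight that is at least \<open>d\<close> is at least
  \<open>d\<close> plus this gap, and exceeds that sum by a multiple of 3.\<close>

definition weight_gap :: "nat \<Rightarrow> gf3 \<Rightarrow> point \<Rightarrow> nat" where
  "weight_gap d e a = residue (e * dot a a - of_nat d)"

lemma conformal_weight_decomp:
  assumes "conformal e W" "d \<le> W a"
  shows "\<exists>f. W a = d + weight_gap d e a + 3 * f"
proof -
  have "of_nat (W a) = (of_nat (d + weight_gap d e a) :: gf3)"
    by (simp add: conformalD(1)[OF assms(1)] weight_gap_def of_nat_residue)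
  then have "of_nat (d + (W a - d)) = (of_nat (d + weight_gap d e a) :: gf3)" using assms(2) by simp
  then have "of_nat (W a - d) = (of_nat (weight_gap d e a) :: gf3)" unfolding of_nat_add by simp
  then have "(W a - d) mod 3 = weight_gap d e a mod 3" by (simp add: of_nat_gf3_eq)
  also have "\<dots> = weight_gap d e a" using residue_less by (simp add: weight_gap_def)
  finally have "W a - d = weight_gap d e a + 3 * ((W a - d) div 3)" by (metis add.commute mult_div_mod_eq)
  then show ?thesis using assms(2) by (intro exI[of _ "(W a - d) div 3"]) linarith
qed

lemma sum_weight_gap_off_hyperplane:
  assumes "e \<noteq> 0" "p \<noteq> 0"
  shows "12 \<le> (\<Sum>a\<in>UNIV. if dot a p \<noteq> 0 then weight_gap d e a else 0)"
proof -
  have e: "e \<in> {1, -1}" using assms(1) by (cases e rule: gf3_cases) auto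
  have "\<forall>e\<in>{1, -1}. \<forall>x. \<forall>p. p = 0 \<or>
    12 \<le> sum_list (map (\<lambda>a. if dot a p \<noteq> 0 then residue (e * dot a a - x) else 0) enum_class.enum)"
    by code_simp
  then have *: "12 \<le> sum_list (map (\<lambda>a. if dot a p \<noteq> 0 then residue (e * dot a a - x) else 0) enum_class.enum)" for x
    using e assms(2) by blast
  show ?thesis using *[of "of_nat d"]
    unfolding weight_gap_def by (simp add: sum_list_distinct_conv_sum_set enum_distinct enum_UNIV)
qed

lemma sum_norm_off_hyperplane:
  "(\<Sum>a\<in>UNIV. if dot a p \<noteq> 0 then dot a a else 0) = 0"
proof -
  let ?f = "\<lambda>a. if dot a p \<noteq> 0 then residue (dot a a) else 0"
  have "\<forall>p. sum_list (map (\<lambda>a. if dot a p \<noteq> 0 then residue (dot a a) else 0) enum_class.enum) mod 3 = 0"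
    by code_simp
  then have "sum_list (map ?f enum_class.enum) mod 3 = 0" by blast
  then have "(\<Sum>a\<in>UNIV. ?f a) mod 3 = 0 mod 3"
    by (simp add: sum_list_distinct_conv_sum_set enum_distinct enum_UNIV)
  then have "of_nat (\<Sum>a\<in>UNIV. ?f a) = (of_nat 0 :: gf3)" unfolding of_nat_gf3_eq .
  moreover have "of_nat (\<Sum>a\<in>UNIV. ?f a) = (\<Sum>a\<in>UNIV. if dot a p \<noteq> 0 then dot a a else 0)"
    unfolding of_nat_sum by (rule sum.cong) (auto simp: of_nat_residue)
  ultimately show ?thesis by simp
qed

section \<open>Realizing weight functions by columns\<close>

text \<open>The evident necessary conditions on the weight function of a code of length \<open>n\<close> without zero
  column, of minimum weight at least \<open>d\<close> and with an orthogonal basis of norm \<open>e\<close>; they turn out to be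
  sufficient if \<open>2 n \<le> 3 d + 2\<close>. The last one excludes zero columns since every nonzero column
  contributes 18 to the sum.\<close>

definition weight_class :: "nat \<Rightarrow> nat \<Rightarrow> gf3 \<Rightarrow> (point \<Rightarrow> nat) set" where
  "weight_class n d e = {W. conformal e W \<and> W 0 = 0 \<and> (\<forall>a. W (- a) = W a) \<and>
     (\<forall>a. a \<noteq> 0 \<longrightarrow> d \<le> W a) \<and> (\<Sum>a\<in>UNIV. W a) = 18 * n}"

lemma weight_classD:
  assumes "W \<in> weight_class n d e"
  shows "conformal e W" "W 0 = 0" "W (- a) = W a" "a \<noteq> 0 \<Longrightarrow> d \<le> W a" "(\<Sum>a\<in>UNIV. W a) = 18 * n"
  using assms unfolding weight_class_def by blast+

lemma sum_weight_off_hyperplane_ge: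
  assumes "\<And>a. a \<noteq> 0 \<Longrightarrow> d + weight_gap d e a \<le> W a"
  shows "(\<Sum>a\<in>UNIV. if dot a p \<noteq> 0 then W a else 0) \<ge>
    d * (\<Sum>a\<in>UNIV. if dot a p \<noteq> 0 then 1 else 0) + (\<Sum>a\<in>UNIV. if dot a p \<noteq> 0 then weight_gap d e a else 0)"
proof -
  have "(if dot a p \<noteq> 0 then d * 1 else 0) + (if dot a p \<noteq> 0 then weight_gap d e a else 0) \<le> (if dot a p \<noteq> 0 then W a else 0)" for a
    using assms[of a] by (cases "a = 0") simp_all
  then have "(\<Sum>a\<in>UNIV. (if dot a p \<noteq> 0 then d * 1 else 0) + (if dot a p \<noteq> 0 then weight_gap d e a else 0)) \<le> (\<Sum>a\<in>UNIV. if dot a p \<noteq> 0 then W a else 0)"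
    by (rule sum_mono)
  moreover have "(\<Sum>a\<in>UNIV. if dot a p \<noteq> 0 then d * 1 else 0) = d * (\<Sum>a\<in>UNIV. if dot a p \<noteq> 0 then 1 else 0)"
    unfolding sum_distrib_left by (rule sum.cong) auto
  ultimately show ?thesis by (simp add: sum.distrib)
qed

text \<open>By double counting, \<open>m\<close> must be the number of columns on the line of \<open>p\<close>. Integrality comes from the
  residues modulo 3 and the symmetry \<open>W (- a) = W a\<close>. Nonnegativity is where \<open>n\<close> has to be small
  relative to \<open>d\<close>: 18 weights of size at least \<open>d\<close>, with gaps adding up to at least 12, are summed.\<close>

lemma multiplicity_exists:
  assumes W: "W \<in> weight_class n d e" and n: "2 * n \<le> 3 * d + 2" and p: "p \<noteq> 0"
  shows "\<exists>m. (\<Sum>a\<in>UNIV. if dot a p \<noteq> 0 then W a else 0) = 12 * n + 6 * m"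
proof -
  let ?h = "\<lambda>a. if dot a p \<noteq> 0 then W a else 0"
  have e: "e \<noteq> 0" using conformalD(2)[OF weight_classD(1)[OF W]] .
  have low: "d + weight_gap d e a \<le> W a" if "a \<noteq> 0" for a
    using conformal_weight_decomp[OF weight_classD(1)[OF W] weight_classD(4)[OF W that]] by auto
  have "d * 18 + 12 \<le> (\<Sum>a\<in>UNIV. ?h a)"
    using sum_weight_off_hyperplane_ge[of d e W p, OF low] card_not_orthogonal[of p] p sum_weight_gap_off_hyperplane[OF e p, of d]
    by (simp add: dot_commute)
  then have ge: "12 * n \<le> (\<Sum>a\<in>UNIV. ?h a)" using n by linarith
  have even: "(\<Sum>a\<in>UNIV. ?h a) = 2 * (\<Sum>a\<in>set points. ?h a)"
    by (rule sum_even) (simp_all add: weight_classD(3)[OF W])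
  have "(of_nat (\<Sum>a\<in>UNIV. ?h a) :: gf3) = (\<Sum>a\<in>UNIV. e * (if dot a p \<noteq> 0 then dot a a else 0))"
    unfolding of_nat_sum by (rule sum.cong) (auto simp: conformalD(1)[OF weight_classD(1)[OF W]])
  also have "\<dots> = of_nat 0" using sum_norm_off_hyperplane[of p] by (simp flip: sum_distrib_left)
  finally have "(\<Sum>a\<in>UNIV. ?h a) mod 3 = 0" unfolding of_nat_gf3_eq by simp
  then have "3 dvd (\<Sum>a\<in>UNIV. ?h a)" by (rule dvd_eq_mod_eq_0[THEN iffD2])
  moreover have "2 dvd (\<Sum>a\<in>UNIV. ?h a)" unfolding even by simp
  ultimately have "6 dvd (\<Sum>a\<in>UNIV. ?h a)" by presburger
  then have "6 dvd (\<Sum>a\<in>UNIV. ?h a) - 12 * n" by (rule dvd_diff_nat) simp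
  then obtain m where "(\<Sum>a\<in>UNIV. ?h a) - 12 * n = 6 * m" by blast
  then show ?thesis using ge by (intro exI[of _ m]) linarith
qed

text \<open>Take as many copies of each point as the double counting formula demands. That formula is a linear
  system whose matrix is inverted by the same incidence numbers 18 and 12, so the constructed
  columns have the prescribed weights.\<close>

lemma weight_class_realized:
  assumes W: "W \<in> weight_class n d e" and n: "2 * n \<le> 3 * d + 2"
  shows "\<exists>g. weight n g = W \<and> (\<forall>i<n. g i \<noteq> 0)"
proof -
  let ?T = "\<lambda>p. \<Sum>a\<in>UNIV. if dot a p \<noteq> 0 then W a else 0"
  have "\<exists>m. \<forall>p. p \<noteq> 0 \<longrightarrow> ?T p = 12 * n + 6 * m p"
    using multiplicity_exists[OF W n] by (intro choice) blast
  then obtain m0 where m0: "?T p = 12 * n + 6 * m0 p" if "p \<noteq> 0" for p by blast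
  define m where "m = (\<lambda>p. if p = 0 then 0 else m0 p)"
  have m: "?T p = 12 * n + 6 * m p" if "p \<noteq> 0" for p using m0[OF that] that by (simp add: m_def)
  have m_even: "m (- p) = m p" for p
    using m[of p] m[of "- p"] by (cases "p = 0") (simp_all add: m_def)
  have T0: "?T 0 = 0" by simp
  \<comment> \<open>Summing over the points off the hyperplane of \<open>b\<close> counts \<open>W b\<close> and \<open>W (- b)\<close> 18 times and all
    other weights 12 times; the total weight \<open>18 n\<close> gives \<open>216 n = 12 * 18 n\<close>.\<close>
  have incidence: "(\<Sum>p\<in>UNIV. if dot b p \<noteq> 0 then ?T p else 0) = 216 * n + 12 * W b" if "b \<noteq> 0" for b
  proof -
    have "(\<Sum>p\<in>UNIV. if dot b p \<noteq> 0 then ?T p else 0)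
        = (\<Sum>p\<in>UNIV. \<Sum>a\<in>UNIV. if dot p a \<noteq> 0 \<and> dot p b \<noteq> 0 then W a else 0)"
      by (intro sum.cong refl) (simp add: dot_commute)
    also have "\<dots> = (\<Sum>a\<in>UNIV. \<Sum>p\<in>UNIV. if dot p a \<noteq> 0 \<and> dot p b \<noteq> 0 then W a else 0)"
      by (rule sum.swap)
    also have "\<dots> = (\<Sum>a\<in>UNIV. W a * common_support a b)"
      unfolding common_support_sum sum_distrib_left by (intro sum.cong refl) auto
    also have "\<dots> = (\<Sum>a\<in>UNIV. 12 * W a + ((if a = b then 6 * W b else 0) + (if a = - b then 6 * W b else 0)))"
    proof (rule sum.cong)
      fix a
      have "b \<noteq> - b" using that by (metis (no_types, lifting) add.inverse_inverse points_cover)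
      then show "W a * common_support a b = 12 * W a + ((if a = b then 6 * W b else 0) + (if a = - b then 6 * W b else 0))"
        using that weight_classD(2,3)[OF W] by (auto simp: common_support_value)
    qed simp
    also have "\<dots> = 12 * (\<Sum>a\<in>UNIV. W a) + 12 * W b"
      by (simp add: sum.distrib flip: sum_distrib_left)
    finally show ?thesis using weight_classD(5)[OF W] by simp
  qed
  have half: "(\<Sum>p\<in>UNIV. if dot b p \<noteq> 0 then m p else 0) = 2 * (\<Sum>p\<in>set points. if dot b p \<noteq> 0 then m p else 0)" for b
    by (rule sum_even) (simp_all add: m_even)
  have recover: "(\<Sum>p\<in>set points. if dot b p \<noteq> 0 then m p else 0) = W b" for b
  proof (cases "b = 0")
    case True
    then show ?thesis using weight_classD(2)[OF W] by simp
  next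
    case False
    have "(\<Sum>p\<in>UNIV. if dot b p \<noteq> 0 then ?T p else 0)
        = (\<Sum>p\<in>UNIV. 12 * n * (if dot p b \<noteq> 0 then 1 else 0) + 6 * (if dot b p \<noteq> 0 then m p else 0))"
    proof (rule sum.cong)
      fix p
      show "(if dot b p \<noteq> 0 then ?T p else 0) = 12 * n * (if dot p b \<noteq> 0 then 1 else 0) + 6 * (if dot b p \<noteq> 0 then m p else 0)"
        using m[of p] by (cases "p = 0") (simp_all add: dot_commute)
    qed simp
    also have "\<dots> = 216 * n + 6 * (\<Sum>p\<in>UNIV. if dot b p \<noteq> 0 then m p else 0)"
      unfolding sum.distrib sum_distrib_left[symmetric] card_not_orthogonal using False by simp
    finally show ?thesis using incidence[OF False] half[of b] by linarith
  qed
  \<comment> \<open>Each weight is counted 18 times in the total of all \<open>?T p\<close>, and \<open>324 n = 18 * 18 n\<close>.\<close>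
  have total: "(\<Sum>p\<in>set points. m p) = n"
  proof -
    have "(\<Sum>p\<in>UNIV. ?T p) = (\<Sum>a\<in>UNIV. W a * (\<Sum>p\<in>UNIV. if dot p a \<noteq> 0 then 1 else 0))"
      unfolding sum_distrib_left by (subst sum.swap) (intro sum.cong refl, auto simp: dot_commute)
    also have "\<dots> = (\<Sum>a\<in>UNIV. 18 * W a)"
      unfolding card_not_orthogonal using weight_classD(2)[OF W] by (intro sum.cong) auto
    finally have "(\<Sum>p\<in>UNIV. ?T p) = 324 * n" using weight_classD(5)[OF W] by (simp flip: sum_distrib_left)
    moreover have "(\<Sum>p\<in>UNIV. ?T p) = 2 * (\<Sum>p\<in>set points. ?T p)"
      using weight_classD(3)[OF W] by (intro sum_even) simp_all
    moreover have "(\<Sum>p\<in>set points. ?T p) = (\<Sum>p\<in>set points. 12 * n + 6 * m p)"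
      using points_cover(2) by (intro sum.cong refl m) auto
    moreover have "\<dots> = 156 * n + 6 * (\<Sum>p\<in>set points. m p)"
      using distinct_card[OF distinct_points] by (simp add: sum.distrib flip: sum_distrib_left)
    ultimately show ?thesis by linarith
  qed
  define cols where "cols = concat (map (\<lambda>p. replicate (m p) p) points)"
  have len: "length cols = n"
    using total distinct_points by (simp add: cols_def length_concat o_def sum_list_distinct_conv_sum_set)
  have "weight n (nth cols) b = W b" for b
  proof -
    have "weight n (nth cols) b = length (filter (\<lambda>p. dot b p \<noteq> 0) cols)"
      by (simp add: weight_def length_filter_conv_card len)
    also have "\<dots> = (\<Sum>p\<leftarrow>points. if dot b p \<noteq> 0 then m p else 0)"
      by (simp add: cols_def filter_concat length_concat o_def)
        (intro arg_cong[of _ _ sum_list] map_cong refl, simp)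
    also have "\<dots> = W b"
      using recover[of b] distinct_points by (simp add: sum_list_distinct_conv_sum_set)
    finally show ?thesis .
  qed
  moreover have "cols ! i \<noteq> 0" if "i < n" for i
  proof -
    have "cols ! i \<in> set cols" using that len by simp
    then show ?thesis using points_cover(2) by (auto simp: cols_def)
  qed
  ultimately show ?thesis by (intro exI[of _ "nth cols"]) auto
qed

section \<open>Orbits of lists of length 13\<close>

text \<open>The 24 permutations of the 13 lines induced by the 48 signed permutation matrices, which are all the
  orthogonal \<open>3 \<times> 3\<close> matrices; a matrix and its negative induce the same permutation. The entries refer
  to positions in \<open>points\<close>.\<close>

definition point_perms :: "nat list list" where
  "point_perms = [[0,1,2,3,4,5,6,7,8,9,10,11,12],
     [0,1,2,3,4,6,5,10,12,11,7,9,8],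
     [0,1,3,2,4,5,6,10,11,12,7,8,9],
     [0,1,3,2,4,6,5,7,9,8,10,12,11],
     [0,4,5,6,1,2,3,7,8,9,10,12,11],
     [0,4,5,6,1,3,2,10,11,12,7,9,8],
     [0,4,6,5,1,2,3,10,12,11,7,8,9],
     [0,4,6,5,1,3,2,7,9,8,10,11,12],
     [1,0,2,3,4,7,10,5,8,11,6,9,12],
     [1,0,2,3,4,10,7,6,12,9,5,11,8],
     [1,0,3,2,4,7,10,6,9,12,5,8,11],
     [1,0,3,2,4,10,7,5,11,8,6,12,9],
     [1,4,7,10,0,2,3,5,8,11,6,12,9],
     [1,4,7,10,0,3,2,6,9,12,5,11,8],
     [1,4,10,7,0,2,3,6,12,9,5,8,11],
     [1,4,10,7,0,3,2,5,11,8,6,9,12],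
     [4,0,5,6,1,7,10,2,8,12,3,9,11],
     [4,0,5,6,1,10,7,3,11,9,2,12,8],
     [4,0,6,5,1,7,10,3,9,11,2,8,12],
     [4,0,6,5,1,10,7,2,12,8,3,11,9],
     [4,1,7,10,0,5,6,2,8,12,3,11,9],
     [4,1,7,10,0,6,5,3,9,11,2,12,8],
     [4,1,10,7,0,5,6,3,11,9,2,8,12],
     [4,1,10,7,0,6,5,2,12,8,3,9,11]]"

fun lex_le :: "nat list \<Rightarrow> nat list \<Rightarrow> bool" where
  "lex_le [] ys = True"
| "lex_le (x # xs) [] = False"
| "lex_le (x # xs) (y # ys) =
     (if x < y then True else if x = y then lex_le xs ys else False)"

text \<open>The Boolean accumulator stops the comparison at the first failure under symbolic evaluation, which
  evaluates all arguments of a conjunction.\<close>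

fun lex_le_all :: "bool \<Rightarrow> nat list \<Rightarrow> nat list list \<Rightarrow> bool" where
  "lex_le_all False xs yss = False"
| "lex_le_all True xs [] = True"
| "lex_le_all True xs (ys # yss) = lex_le_all (lex_le xs ys) xs yss"

fun incr_hd :: "nat list \<Rightarrow> nat list" where
  "incr_hd [] = []"
| "incr_hd (x # xs) = Suc x # xs"

text \<open>All lists of length \<open>n\<close> with sum \<open>k\<close>, split by whether the first entry is zero. The recursion is first
  order because symbolic evaluation would unfold recursive calls below an abstraction.\<close>

fun compositions :: "nat \<Rightarrow> nat \<Rightarrow> nat list list" where
  "compositions 0 0 = [[]]"
| "compositions 0 (Suc k) = []"
| "compositions (Suc n) 0 = map ((#) 0) (compositions n 0)"
| "compositions (Suc n) (Suc k) =
     map ((#) 0) (compositions n (Suc k)) @ map incr_hd (compositions (Suc n) k)"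

text \<open>Canonical lists are lexicographically least in their orbit, so every orbit contains exactly one.\<close>

definition canonical :: "nat list \<Rightarrow> bool" where
  "canonical L \<longleftrightarrow> lex_le_all True L (map (map ((!) L)) point_perms)"

text \<open>With the 24 images written out, an evaluation step needs no list lookups.\<close>

lemma canonical_code [code]:
  "canonical [a0,a1,a2,a3,a4,a5,a6,a7,a8,a9,a10,a11,a12] \<longleftrightarrow>
   lex_le_all True [a0,a1,a2,a3,a4,a5,a6,a7,a8,a9,a10,a11,a12] [[a0,a1,a2,a3,a4,a5,a6,a7,a8,a9,a10,a11,a12],
       [a0,a1,a2,a3,a4,a6,a5,a10,a12,a11,a7,a9,a8],
       [a0,a1,a3,a2,a4,a5,a6,a10,a11,a12,a7,a8,a9],
       [a0,a1,a3,a2,a4,a6,a5,a7,a9,a8,a10,a12,a11],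
       [a0,a4,a5,a6,a1,a2,a3,a7,a8,a9,a10,a12,a11],
       [a0,a4,a5,a6,a1,a3,a2,a10,a11,a12,a7,a9,a8],
       [a0,a4,a6,a5,a1,a2,a3,a10,a12,a11,a7,a8,a9],
       [a0,a4,a6,a5,a1,a3,a2,a7,a9,a8,a10,a11,a12],
       [a1,a0,a2,a3,a4,a7,a10,a5,a8,a11,a6,a9,a12],
       [a1,a0,a2,a3,a4,a10,a7,a6,a12,a9,a5,a11,a8],
       [a1,a0,a3,a2,a4,a7,a10,a6,a9,a12,a5,a8,a11],
       [a1,a0,a3,a2,a4,a10,a7,a5,a11,a8,a6,a12,a9],
       [a1,a4,a7,a10,a0,a2,a3,a5,a8,a11,a6,a12,a9],
       [a1,a4,a7,a10,a0,a3,a2,a6,a9,a12,a5,a11,a8],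
       [a1,a4,a10,a7,a0,a2,a3,a6,a12,a9,a5,a8,a11],
       [a1,a4,a10,a7,a0,a3,a2,a5,a11,a8,a6,a9,a12],
       [a4,a0,a5,a6,a1,a7,a10,a2,a8,a12,a3,a9,a11],
       [a4,a0,a5,a6,a1,a10,a7,a3,a11,a9,a2,a12,a8],
       [a4,a0,a6,a5,a1,a7,a10,a3,a9,a11,a2,a8,a12],
       [a4,a0,a6,a5,a1,a10,a7,a2,a12,a8,a3,a11,a9],
       [a4,a1,a7,a10,a0,a5,a6,a2,a8,a12,a3,a11,a9],
       [a4,a1,a7,a10,a0,a6,a5,a3,a9,a11,a2,a12,a8],
       [a4,a1,a10,a7,a0,a5,a6,a3,a11,a9,a2,a8,a12],
       [a4,a1,a10,a7,a0,a6,a5,a2,a12,a8,a3,a9,a11]]"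
  unfolding canonical_def point_perms_def by (simp del: lex_le_all.simps lex_le.simps)

definition canonical_count :: "nat list \<Rightarrow> nat" where
  "canonical_count L = (if canonical L then 1 else 0)"

definition num_canonical :: "nat \<Rightarrow> nat" where
  "num_canonical k = sum_list (map canonical_count (compositions 13 k))"

definition list_orbit :: "nat list \<Rightarrow> nat list set" where
  "list_orbit L = (\<lambda>s. map ((!) L) s) ` set point_perms"

lemma lex_le_iff: "length xs = length ys \<Longrightarrow> lex_le xs ys \<longleftrightarrow> xs \<le> ys"
  by (induction xs ys rule: lex_le.induct) auto

lemma lex_le_all_iff: "lex_le_all b xs yss \<longleftrightarrow> b \<and> (\<forall>ys\<in>set yss. lex_le xs ys)"
  by (induction b xs yss rule: lex_le_all.induct) auto

lemma set_compositions: "set (compositions n k) = {L. length L = n \<and> sum_list L = k}"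
proof (induction n k rule: compositions.induct)
  case (4 n k)
  have "L \<in> set (compositions (Suc n) (Suc k))" if L: "length L = Suc n" "sum_list L = Suc k" for L
  proof -
    obtain x xs where x: "L = x # xs" using L by (cases L) auto
    show ?thesis
    proof (cases x)
      case 0
      then have "L \<in> (#) 0 ` set (compositions n (Suc k))" using 4 L x by auto
      then show ?thesis by simp
    next
      case (Suc y)
      then have "y # xs \<in> set (compositions (Suc n) k)" using 4 L x by auto
      moreover have "L = incr_hd (y # xs)" using Suc x by simp
      ultimately have "L \<in> incr_hd ` set (compositions (Suc n) k)" by blast
      then show ?thesis by simp
    qed
  qed
  moreover have "length L = Suc n \<and> sum_list L = Suc k" if "L \<in> set (compositions (Suc n) (Suc k))" for L
    using that 4 by (auto elim!: incr_hd.elims simp: length_Suc_conv)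
  ultimately show ?case by blast
qed (auto simp: length_Suc_conv)

lemma distinct_compositions: "distinct (compositions n k)"
proof (induction n k rule: compositions.induct)
  case (4 n k)
  have ne: "\<exists>x xs. L = x # xs" if "L \<in> set (compositions (Suc n) k)" for L
    by (cases L) (use that in \<open>auto simp: set_compositions\<close>)
  have "inj_on incr_hd (set (compositions (Suc n) k))"
  proof (rule inj_onI)
    fix L M assume "L \<in> set (compositions (Suc n) k)" "M \<in> set (compositions (Suc n) k)"
      and eq: "incr_hd L = incr_hd M"
    then obtain x xs y ys where "L = x # xs" "M = y # ys" using ne by blast
    then show "L = M" using eq by simp
  qed
  moreover have "(#) 0 ` set (compositions n (Suc k)) \<inter> incr_hd ` set (compositions (Suc n) k) = {}"
    using ne by fastforce
  moreover have "inj_on ((#) 0) (set (compositions n (Suc k)))" by (rule inj_onI) simp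
  ultimately show ?case using 4 unfolding compositions.simps(4) distinct_append distinct_map set_map by blast
next
  case (3 n)
  moreover have "inj_on ((#) 0) (set (compositions n 0))" by (rule inj_onI) simp
  ultimately show ?case unfolding compositions.simps(3) distinct_map by blast
qed simp_all

lemma point_perms_permute: "s \<in> set point_perms \<Longrightarrow> mset s = mset [0..<13]"
proof -
  have "list_all (\<lambda>s. sort s = [0..<13]) point_perms" by code_simp
  then show "s \<in> set point_perms \<Longrightarrow> mset s = mset [0..<13]"
    unfolding list_all_iff by (metis mset_sort)
qed

lemma point_perms_comp:
  "s \<in> set point_perms \<Longrightarrow> t \<in> set point_perms \<Longrightarrow> map ((!) s) t \<in> set point_perms"
proof -
  have "list_all (\<lambda>s. list_all (\<lambda>t. List.member point_perms (map ((!) s) t)) point_perms) point_perms"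
    by code_simp
  then show "s \<in> set point_perms \<Longrightarrow> t \<in> set point_perms \<Longrightarrow> map ((!) s) t \<in> set point_perms"
    by (simp add: list_all_iff)
qed

lemma point_perms_inverse:
  "s \<in> set point_perms \<Longrightarrow> \<exists>t\<in>set point_perms. map ((!) s) t = [0..<13]"
proof -
  have "list_all (\<lambda>s. list_ex (\<lambda>t. map ((!) s) t = [0..<13]) point_perms) point_perms"
    by code_simp
  then show "s \<in> set point_perms \<Longrightarrow> \<exists>t\<in>set point_perms. map ((!) s) t = [0..<13]"
    by (simp add: list_all_iff list_ex_iff)
qed

lemma point_perms_id: "[0..<13] \<in> set point_perms"
  by (simp add: point_perms_def upt_rec)

lemma map_nth_map_nth:
  assumes "s \<in> set point_perms" "t \<in> set point_perms"
  shows "map ((!) (map ((!) L) s)) t = map ((!) L) (map ((!) s) t)"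
proof -
  have "length s = 13" "set t = {..<13}"
    using point_perms_permute[OF assms(1)] point_perms_permute[OF assms(2)]
    by (metis length_upt mset_eq_length diff_zero, metis atLeast0LessThan atLeastLessThan_upt mset_eq_setD)
  then show ?thesis by auto
qed

lemma list_orbit_self: "length L = 13 \<Longrightarrow> L \<in> list_orbit L"
  using point_perms_id map_nth[of L] unfolding list_orbit_def by (metis imageI)

lemma list_orbit_eq:
  assumes "length L = 13" "M \<in> list_orbit L"
  shows "list_orbit M = list_orbit L"
proof -
  obtain s where s: "s \<in> set point_perms" "M = map ((!) L) s" using assms by (auto simp: list_orbit_def)
  obtain t where t: "t \<in> set point_perms" "map ((!) s) t = [0..<13]" using point_perms_inverse[OF s(1)] by blast
  have L: "L = map ((!) M) t"
    by (metis assms(1) map_nth map_nth_map_nth[OF s(1) t(1)] s(2) t(2))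
  have sub: "list_orbit (map ((!) K) u) \<subseteq> list_orbit K" if "u \<in> set point_perms" for K u
    using that by (auto simp: list_orbit_def map_nth_map_nth point_perms_comp simp del: map_map)
  show ?thesis using sub[OF s(1), of L] sub[OF t(1), of M] by (metis L s(2) subset_antisym)
qed

lemma list_orbit_sum:
  assumes "length L = 13" "M \<in> list_orbit L"
  shows "length M = 13" "sum_list M = sum_list L"
proof -
  obtain s where s: "s \<in> set point_perms" "M = map ((!) L) s" using assms by (auto simp: list_orbit_def)
  have "mset M = image_mset ((!) L) (mset s)" by (simp add: s)
  also have "\<dots> = mset (map ((!) L) [0..<13])" by (simp only: point_perms_permute[OF s(1)] mset_map)
  also have "\<dots> = mset L" using map_nth[of L] assms(1) by simp
  finally have "mset M = mset L" .
  then show "length M = 13" "sum_list M = sum_list L" using assms(1)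
    by (metis mset_eq_length, metis sum_mset_sum_list)
qed

lemma canonical_iff_Min:
  assumes "length L = 13"
  shows "canonical L \<longleftrightarrow> L = Min (list_orbit L)"
proof -
  have "canonical L \<longleftrightarrow> (\<forall>M\<in>list_orbit L. lex_le L M)"
    by (simp add: canonical_def lex_le_all_iff list_orbit_def)
  also have "\<dots> \<longleftrightarrow> (\<forall>M\<in>list_orbit L. L \<le> M)"
    using list_orbit_sum(1)[OF assms] assms lex_le_iff by metis
  also have "\<dots> \<longleftrightarrow> L = Min (list_orbit L)"
    using list_orbit_self[OF assms] Min_le[of "list_orbit L"]
    by (metis Min_eqI finite_imageI finite_set list_orbit_def)
  finally show ?thesis .
qed

lemma sum_canonical_count: "sum_list (map canonical_count Ls) = length (filter canonical Ls)"
  by (induction Ls) (auto simp: canonical_count_def)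

lemma card_list_orbits:
  "card (list_orbit ` {L. length L = 13 \<and> sum_list L = k}) = num_canonical k"
proof -
  let ?A = "{L. length L = 13 \<and> sum_list L = k}" and ?C = "{L. length L = 13 \<and> sum_list L = k \<and> canonical L}"
  have "bij_betw list_orbit ?C (list_orbit ` ?A)"
    unfolding bij_betw_def
  proof
    show "inj_on list_orbit ?C"
      by (rule inj_onI) (metis (mono_tags, lifting) canonical_iff_Min mem_Collect_eq)
    show "list_orbit ` ?C = list_orbit ` ?A"
    proof (intro equalityI subsetI)
      fix X assume "X \<in> list_orbit ` ?A"
      then obtain L where L: "length L = 13" "sum_list L = k" "X = list_orbit L" by auto
      define M where "M = Min (list_orbit L)"
      have "M \<in> list_orbit L" unfolding M_def
        using list_orbit_self[OF L(1)] by (intro Min_in) (auto simp: list_orbit_def)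
      then have "M \<in> ?C" "X = list_orbit M"
        using list_orbit_sum[OF L(1)] list_orbit_eq[OF L(1)] L canonical_iff_Min[of M] by (auto simp: M_def)
      then show "X \<in> list_orbit ` ?C" by blast
    qed auto
  qed
  then have "card (list_orbit ` ?A) = card ?C" by (simp add: bij_betw_same_card)
  also have "?C = set (filter canonical (compositions 13 k))" by (auto simp: set_compositions)
  also have "card \<dots> = length (filter canonical (compositions 13 k))"
    by (rule distinct_card) (simp add: distinct_compositions)
  also have "\<dots> = num_canonical k"
    by (simp add: num_canonical_def sum_canonical_count)
  finally show ?thesis .
qed

section \<open>Weight functions as lists of excesses\<close>

definition point_index :: "point \<Rightarrow> nat" where
  "point_index a = length (takeWhile (\<lambda>p. p \<noteq> a \<and> p \<noteq> - a) points)"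

lemma points_nonzero: "a \<in> set points \<Longrightarrow> a \<noteq> 0"
  using points_cover(2) by auto

lemma point_index:
  assumes "a \<noteq> 0"
  shows "point_index a < 13" "points ! point_index a = a \<or> points ! point_index a = - a"
proof -
  let ?P = "\<lambda>p. p \<noteq> a \<and> p \<noteq> - a"
  have "a \<in> set points \<or> - a \<in> set points" using points_cover(1) assms by blast
  then have "\<exists>p\<in>set points. \<not> ?P p" by blast
  then have ne: "takeWhile ?P points \<noteq> points"
    unfolding takeWhile_eq_all_conv by blast
  have lt: "point_index a < length points"
  proof (rule ccontr)
    assume "\<not> ?thesis"
    then have "take (length (takeWhile ?P points)) points = points"
      by (simp add: point_index_def)
    then show False using ne by (simp flip: takeWhile_eq_take)
  qed
  then show "point_index a < 13" by simp
  show "points ! point_index a = a \<or> points ! point_index a = - a"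
    using nth_length_takeWhile[of ?P points] lt unfolding point_index_def by blast
qed

definition frame_perm :: "point \<times> point \<times> point \<Rightarrow> nat list" where
  "frame_perm F = map (\<lambda>a. point_index (act F a)) points"

definition unit_points :: "point list" where
  "unit_points = filter (\<lambda>u. dot u u = 1) enum_class.enum"

definition frame_list :: "(point \<times> point \<times> point) list" where
  "frame_list = filter (\<lambda>(u, v, w). dot u v = 0 \<and> dot u w = 0 \<and> dot v w = 0)
     (List.product unit_points (List.product unit_points unit_points))"

lemma set_frame_list: "set frame_list = orthonormal_frames"
  unfolding frame_list_def unit_points_def orthonormal_frames_def by (auto simp: enum_UNIV)

lemma frame_perm_image: "frame_perm ` orthonormal_frames = set point_perms"
proof -
  have "list_all (List.member point_perms) (map frame_perm frame_list)
    \<and> list_all (List.member (map frame_perm frame_list)) point_perms" by code_simp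
  then show ?thesis unfolding set_frame_list[symmetric] by (auto simp: list_all_iff)
qed

lemma act_zero [simp]: "act F 0 = 0" by (simp add: act_def scale_def prod_eq_iff)

lemma act_uminus: "act F (- a) = - act F a" by (simp add: act_def scale_def prod_eq_iff)

lemma act_inj:
  assumes "F \<in> orthonormal_frames"
  shows "inj (act F)"
proof
  fix a b assume "act F a = act F b"
  then have "dot a c = dot b c" for c using act_isometry[OF assms] by metis
  then have "dot (a - b) c = 0" for c by (simp add: dot_diff)
  from dot_nondegenerate[OF this] show "a = b" by simp
qed

lemma act_nonzero: "F \<in> orthonormal_frames \<Longrightarrow> a \<noteq> 0 \<Longrightarrow> act F a \<noteq> 0"
  using act_inj[of F] by (metis act_zero injD)

lemma weight_class_act:
  assumes W: "W \<in> weight_class n d e" and F: "F \<in> orthonormal_frames"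
  shows "W \<circ> act F \<in> weight_class n d e"
proof -
  have "of_nat ((W \<circ> act F) a) = e * dot a a" for a
    using conformalD(1)[OF weight_classD(1)[OF W], of "act F a"] act_isometry[OF F] by simp
  then have "conformal e (W \<circ> act F)"
    using conformalD(2)[OF weight_classD(1)[OF W]] unfolding conformal_def by blast
  moreover have "bij (act F)" using act_inj[OF F] by (simp add: bij_def finite_UNIV_inj_surj)
  then have "(\<Sum>a\<in>UNIV. (W \<circ> act F) a) = (\<Sum>a\<in>UNIV. W a)"
    unfolding comp_def by (rule sum.reindex_bij_betw)
  moreover have "d \<le> (W \<circ> act F) a" if "a \<noteq> 0" for a
    using weight_classD(4)[OF W act_nonzero[OF F that]] by simp
  moreover have "(W \<circ> act F) (- a) = (W \<circ> act F) a" for a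
    by (simp add: act_uminus weight_classD(3)[OF W])
  ultimately show ?thesis
    using weight_classD(2,5)[OF W] unfolding weight_class_def by (simp del: split_paired_All)
qed

text \<open>How often 3 has to be added to the least admissible weight, at each of the 13 points. The
  correspondence between weight functions and these lists is equivariant, and the length of the
  code fixes the sum of the entries.\<close>

definition excess_list :: "nat \<Rightarrow> gf3 \<Rightarrow> (point \<Rightarrow> nat) \<Rightarrow> nat list" where
  "excess_list d e W = map (\<lambda>a. (W a - (d + weight_gap d e a)) div 3) points"

definition gap_sum :: "nat \<Rightarrow> gf3 \<Rightarrow> nat" where
  "gap_sum d e = (\<Sum>a\<in>set points. weight_gap d e a)"

lemma weight_gap_uminus [simp]: "weight_gap d e (- a) = weight_gap d e a"
  by (simp add: weight_gap_def)

lemma weight_class_excess: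
  assumes "W \<in> weight_class n d e" "a \<noteq> 0"
  shows "W a = d + weight_gap d e a + 3 * ((W a - (d + weight_gap d e a)) div 3)"
  using conformal_weight_decomp[OF weight_classD(1)[OF assms(1)] weight_classD(4)[OF assms]] by auto

lemma excess_list_act:
  assumes W: "W \<in> weight_class n d e" and F: "F \<in> orthonormal_frames"
  shows "excess_list d e (W \<circ> act F) = map ((!) (excess_list d e W)) (frame_perm F)"
proof -
  have "((W \<circ> act F) a - (d + weight_gap d e a)) div 3 = excess_list d e W ! point_index (act F a)"
    if "a \<in> set points" for a
  proof -
    have "a \<noteq> 0" by (rule points_nonzero[OF that])
    then have nz: "act F a \<noteq> 0" by (rule act_nonzero[OF F])
    have "weight_gap d e (act F a) = weight_gap d e a" by (simp add: weight_gap_def act_isometry[OF F])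
    moreover have "W (points ! point_index (act F a)) = W (act F a)"
      "weight_gap d e (points ! point_index (act F a)) = weight_gap d e (act F a)"
      using point_index(2)[OF nz] by (metis weight_classD(3)[OF W], metis weight_gap_uminus)
    ultimately show ?thesis
      using point_index(1)[OF nz] by (simp add: excess_list_def)
  qed
  then show ?thesis unfolding frame_perm_def excess_list_def[of d e "W \<circ> act F"] by simp
qed

lemma excess_list_inj: "inj_on (excess_list d e) (weight_class n d e)"
proof (rule inj_onI)
  fix V W assume V: "V \<in> weight_class n d e" and W: "W \<in> weight_class n d e"
    and eq: "excess_list d e V = excess_list d e W"
  have pt: "V a = W a" if "a \<in> set points" for a
  proof -
    have "a \<noteq> 0" by (rule points_nonzero[OF that])
    moreover have "(V a - (d + weight_gap d e a)) div 3 = (W a - (d + weight_gap d e a)) div 3"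
      using eq that by (simp add: excess_list_def)
    ultimately show ?thesis using weight_class_excess[OF V] weight_class_excess[OF W] by metis
  qed
  show "V = W"
  proof
    fix a
    show "V a = W a"
      using points_cover(1)[of a] pt weight_classD(2,3)[OF V] weight_classD(2,3)[OF W] by metis
  qed
qed

text \<open>Over all points the weights sum up to \<open>18 n\<close>, and to half of that over the representatives;
  conversely any list with the right sum can be extended symmetrically to a weight function.\<close>

lemma excess_list_image:
  assumes e: "e \<noteq> 0"
  shows "excess_list d e ` weight_class n d e =
    {L. length L = 13 \<and> 13 * d + gap_sum d e + 3 * sum_list L = 9 * n}" (is "_ = ?R")
proof
  have sum: "(\<Sum>a\<in>set points. d + weight_gap d e a + 3 * f a) = 13 * d + gap_sum d e + 3 * (\<Sum>a\<in>set points. f a)" for f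
    using distinct_card[OF distinct_points] by (simp add: sum.distrib gap_sum_def sum_distrib_left)
  show "excess_list d e ` weight_class n d e \<subseteq> ?R"
  proof
    fix L assume "L \<in> excess_list d e ` weight_class n d e"
    then obtain W where W: "W \<in> weight_class n d e" and L: "L = excess_list d e W" by blast
    let ?f = "\<lambda>a. (W a - (d + weight_gap d e a)) div 3"
    have "18 * n = 2 * (\<Sum>a\<in>set points. W a)"
      using sum_even[of W] weight_classD(2,3,5)[OF W] by simp
    also have "(\<Sum>a\<in>set points. W a) = (\<Sum>a\<in>set points. d + weight_gap d e a + 3 * ?f a)"
      by (intro sum.cong refl weight_class_excess[OF W] points_nonzero)
    also have "\<dots> = 13 * d + gap_sum d e + 3 * sum_list L"
      unfolding sum L excess_list_def using distinct_points by (simp add: sum_list_distinct_conv_sum_set)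
    finally show "L \<in> ?R" by (simp add: L excess_list_def)
  qed
  show "?R \<subseteq> excess_list d e ` weight_class n d e"
  proof
    fix L assume L: "L \<in> ?R"
    define W where "W = (\<lambda>a. if a = 0 then 0 else d + weight_gap d e a + 3 * L ! point_index a)"
    have even: "W (- a) = W a" for a
      by (simp add: W_def point_index_def conj_commute)
    have "of_nat (W a) = e * dot a a" for a
      by (simp add: W_def weight_gap_def of_nat_residue gf3_numeral)
    then have "conformal e W" using e unfolding conformal_def by blast
    have idx: "map point_index points = [0..<13]" by code_simp
    have LL: "L = map (\<lambda>a. L ! point_index a) points"
    proof -
      have "L = map ((!) L) (map point_index points)" using L map_nth[of L] by (simp add: idx)
      then show ?thesis by (simp add: o_def)
    qed
    have "(\<Sum>a\<in>set points. W a) = (\<Sum>a\<in>set points. d + weight_gap d e a + 3 * L ! point_index a)"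
      by (rule sum.cong) (simp_all add: W_def points_nonzero)
    also have "\<dots> = 13 * d + gap_sum d e + 3 * sum_list L"
      unfolding sum by (subst (2) LL) (simp add: sum_list_distinct_conv_sum_set distinct_points)
    also have "\<dots> = 9 * n" using L by simp
    finally have "(\<Sum>a\<in>UNIV. W a) = 18 * n" using sum_even[of W, OF _ even] by (simp add: W_def)
    moreover have "W 0 = 0" "\<And>a. a \<noteq> 0 \<Longrightarrow> d \<le> W a" by (simp_all add: W_def)
    ultimately have mem: "W \<in> weight_class n d e"
      using \<open>conformal e W\<close> even unfolding weight_class_def by blast
    have "excess_list d e W = map (\<lambda>a. L ! point_index a) points"
      unfolding excess_list_def by (rule map_cong) (simp_all add: W_def points_nonzero)
    then show "L \<in> excess_list d e ` weight_class n d e" using mem LL by (metis imageI)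
  qed
qed

lemma card_orbits:
  assumes e: "e \<noteq> 0"
  shows "card (orbit ` weight_class n d e) =
    card (list_orbit ` {L. length L = 13 \<and> 13 * d + gap_sum d e + 3 * sum_list L = 9 * n})"
proof -
  let ?E = "excess_list d e" and ?W = "weight_class n d e"
  have orb: "list_orbit (?E W) = ?E ` orbit W" if W: "W \<in> ?W" for W
  proof -
    have "?E ` orbit W = (\<lambda>F. ?E (W \<circ> act F)) ` orthonormal_frames"
      unfolding orbit_def by (simp add: image_image)
    also have "\<dots> = (\<lambda>F. map ((!) (?E W)) (frame_perm F)) ` orthonormal_frames"
      by (rule image_cong) (simp_all add: excess_list_act[OF W])
    also have "\<dots> = list_orbit (?E W)"
      unfolding list_orbit_def frame_perm_image[symmetric] by (simp add: image_image)
    finally show ?thesis by simp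
  qed
  have "orbit ` ?W \<subseteq> Pow ?W" using weight_class_act by (auto simp: orbit_def)
  then have "inj_on ((`) ?E) (orbit ` ?W)"
    by (rule inj_on_subset[OF inj_on_image_Pow[OF excess_list_inj]])
  then have "card (orbit ` ?W) = card ((`) ?E ` orbit ` ?W)" by (simp add: card_image)
  also have "(`) ?E ` orbit ` ?W = list_orbit ` ?E ` ?W"
    by (simp add: image_image orb cong: image_cong)
  finally show ?thesis by (simp only: excess_list_image[OF e])
qed

text \<open>A finite evaluation: the gaps depend on \<open>d\<close> modulo 3 only.\<close>

lemma gap_sum_values:
  "d mod 3 = 0 \<Longrightarrow> gap_sum d 1 = 15" "d mod 3 = 0 \<Longrightarrow> gap_sum d (-1) = 12"
  "d mod 3 = 1 \<Longrightarrow> gap_sum d 1 = 14" "d mod 3 = 1 \<Longrightarrow> gap_sum d (-1) = 11"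
  "d mod 3 = 2 \<Longrightarrow> gap_sum d 1 = 10" "d mod 3 = 2 \<Longrightarrow> gap_sum d (-1) = 16"
proof -
  have list: "gap_sum d e = sum_list (map (\<lambda>a. residue (e * dot a a - x)) points)" if "of_nat d = x" for e x
    using distinct_points that by (simp add: gap_sum_def weight_gap_def sum_list_distinct_conv_sum_set)
  have "d mod 3 = 0 \<Longrightarrow> of_nat d = (0 :: gf3)" "d mod 3 = 1 \<Longrightarrow> of_nat d = (1 :: gf3)"
    "d mod 3 = 2 \<Longrightarrow> of_nat d = (-1 :: gf3)"
    using of_nat_gf3_eq[of d 0] of_nat_gf3_eq[of d 1] of_nat_gf3_eq[of d 2] by (simp_all add: gf3_numeral)
  moreover have "sum_list (map (\<lambda>a. residue (1 * dot a a - 0)) points) = 15"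
    "sum_list (map (\<lambda>a. residue ((-1) * dot a a - 0)) points) = 12"
    "sum_list (map (\<lambda>a. residue (1 * dot a a - 1)) points) = 14"
    "sum_list (map (\<lambda>a. residue ((-1) * dot a a - 1)) points) = 11"
    "sum_list (map (\<lambda>a. residue (1 * dot a a - (-1))) points) = 10"
    "sum_list (map (\<lambda>a. residue ((-1) * dot a a - (-1))) points) = 16"
    by code_simp+
  ultimately show "d mod 3 = 0 \<Longrightarrow> gap_sum d 1 = 15" "d mod 3 = 0 \<Longrightarrow> gap_sum d (-1) = 12"
  "d mod 3 = 1 \<Longrightarrow> gap_sum d 1 = 14" "d mod 3 = 1 \<Longrightarrow> gap_sum d (-1) = 11"
  "d mod 3 = 2 \<Longrightarrow> gap_sum d 1 = 10" "d mod 3 = 2 \<Longrightarrow> gap_sum d (-1) = 16"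
    using list by metis+
qed

section \<open>The optimal minimum weight\<close>

lemma gap_sum_ge: "e \<noteq> 0 \<Longrightarrow> 10 \<le> gap_sum d e"
proof -
  assume "e \<noteq> 0"
  then have e: "e = 1 \<or> e = -1" by (cases e rule: gf3_cases) auto
  have "d mod 3 = 0 \<or> d mod 3 = 1 \<or> d mod 3 = 2" by auto
  then show ?thesis using gap_sum_values[of d] e by auto
qed

lemma nonzero_columns_le: "nonzero_columns n g \<le> n"
proof -
  have "nonzero_columns n g \<le> card {..<n}" unfolding nonzero_columns_def by (rule card_mono) auto
  then show ?thesis by simp
qed

lemma nonzero_columns_eq_iff: "nonzero_columns n g = n \<longleftrightarrow> (\<forall>i<n. g i \<noteq> 0)"
proof
  assume "nonzero_columns n g = n"
  then have "{i. i < n \<and> g i \<noteq> 0} = {..<n}"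
    unfolding nonzero_columns_def by (intro card_subset_eq) auto
  then show "\<forall>i<n. g i \<noteq> 0" by auto
next
  assume "\<forall>i<n. g i \<noteq> 0"
  then have "{i. i < n \<and> g i \<noteq> 0} = {..<n}" by auto
  then show "nonzero_columns n g = n" by (simp add: nonzero_columns_def)
qed

text \<open>A nonzero column is orthogonal to 4 of the 13 points and contributes to the weights at the other
  9, so these weights sum up to at most \<open>9 n\<close>; each of them is at least \<open>d\<close> plus its gap.\<close>

lemma sum_weight_bound:
  assumes conf: "conformal e (weight n g)" and d: "\<And>a. a \<noteq> 0 \<Longrightarrow> d \<le> weight n g a"
  shows "13 * d + gap_sum d e \<le> 9 * n"
proof -
  have "13 * d + gap_sum d e = (\<Sum>a\<in>set points. d + weight_gap d e a)"
    using distinct_card[OF distinct_points] by (simp add: sum.distrib gap_sum_def)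
  also have "\<dots> \<le> (\<Sum>a\<in>set points. weight n g a)"
  proof (rule sum_mono)
    fix a assume "a \<in> set points"
    then obtain f where "weight n g a = d + weight_gap d e a + 3 * f"
      using conformal_weight_decomp[OF conf d] points_nonzero by blast
    then show "d + weight_gap d e a \<le> weight n g a" by simp
  qed
  also have "2 * \<dots> = 18 * nonzero_columns n g"
    using sum_even[of "weight n g"] sum_weight[of n g] by simp
  then have "(\<Sum>a\<in>set points. weight n g a) = 9 * nonzero_columns n g" by simp
  finally show ?thesis using nonzero_columns_le[of n g] by linarith
qed

lemma lcd_code_iff:
  "lcd_code n 3 d C \<longleftrightarrow>
    (\<exists>g e. C = gen_code n g \<and> conformal e (weight n g) \<and> min_weight (gen_code n g) = d)"
proof
  assume "lcd_code n 3 d C"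
  then show "\<exists>g e. C = gen_code n g \<and> conformal e (weight n g) \<and> min_weight (gen_code n g) = d"
    using lcd_exists_generator[of n C] unfolding lcd_code_def by auto
next
  assume "\<exists>g e. C = gen_code n g \<and> conformal e (weight n g) \<and> min_weight (gen_code n g) = d"
  then show "lcd_code n 3 d C" using gen_code_lcd unfolding lcd_code_def by auto
qed

lemma lcd_min_weight_bound:
  assumes conf: "conformal e (weight n g)"
  shows "13 * min_weight (gen_code n g) + 10 \<le> 9 * n"
  using sum_weight_bound[OF conf, of "min_weight (gen_code n g)"]
    min_weight_ge_iff[OF conf, of "min_weight (gen_code n g)"] gap_sum_ge[OF conformalD(2)[OF conf], of "min_weight (gen_code n g)"]
  by auto

text \<open>Since the gaps add up to at least 10, the bound rules out the minimum weight \<open>d + 1\<close> when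
  \<open>9 n < 13 (d + 1) + 10\<close>.\<close>

lemma d3_eq:
  assumes conf: "conformal e (weight n g)" and d: "\<And>a. a \<noteq> 0 \<Longrightarrow> d \<le> weight n g a"
    and n: "9 * n < 13 * d + 23"
  shows "d3 n 3 = d"
proof -
  have le: "m \<le> d" if "lcd_code n 3 m C" for m C
    using that lcd_min_weight_bound n unfolding lcd_code_iff by fastforce
  have "d \<le> min_weight (gen_code n g)" using min_weight_ge_iff[OF conf] d by blast
  moreover have "min_weight (gen_code n g) \<le> d" using lcd_min_weight_bound[OF conf] n by linarith
  ultimately have "lcd_code n 3 d (gen_code n g)" unfolding lcd_code_iff using conf by force
  moreover have "finite {d. \<exists>C. lcd_code n 3 d C}"
    by (rule finite_subset[of _ "{..d}"]) (use le in auto)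
  ultimately show ?thesis unfolding d3_def by (intro Max_eqI) (use le in auto)
qed

lemma optimal_codes_eq:
  assumes n: "n \<ge> 4" "9 * n < 13 * d + 23" and d3: "d3 n 3 = d"
  shows "optimal_lcd_codes_dd2 n 3 = gen_code n ` {g. \<exists>e. weight n g \<in> weight_class n d e}"
proof -
  have "C \<in> optimal_lcd_codes_dd2 n 3 \<longleftrightarrow> (\<exists>g e. C = gen_code n g \<and> weight n g \<in> weight_class n d e)" for C
  proof -
    have "weight n g \<in> weight_class n d e \<longleftrightarrow>
      conformal e (weight n g) \<and> min_weight (gen_code n g) = d \<and> dual_distance n (gen_code n g) \<ge> 2" for g e
    proof (cases "conformal e (weight n g)")
      case True
      have "(\<Sum>a\<in>UNIV. weight n g a) = 18 * n \<longleftrightarrow> dual_distance n (gen_code n g) \<ge> 2"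
        unfolding dual_distance_ge_2_iff[OF n(1)] sum_weight nonzero_columns_eq_iff[symmetric] by simp
      moreover have "(\<forall>a. a \<noteq> 0 \<longrightarrow> d \<le> weight n g a) \<longleftrightarrow> min_weight (gen_code n g) = d"
        unfolding min_weight_ge_iff[OF True, symmetric] using lcd_min_weight_bound[OF True] n(2) by linarith
      ultimately show ?thesis using True unfolding weight_class_def by (simp del: split_paired_All)
    qed (simp add: weight_class_def)
    then show ?thesis
      unfolding optimal_lcd_codes_dd2_def optimal_lcd_code_def lcd_code_iff d3 by auto
  qed
  then show ?thesis by blast
qed

section \<open>Classes of codes as orbits of weight functions\<close>

lemma card_quotient_kernel:
  "card (S // {(x, y). x \<in> S \<and> y \<in> S \<and> J x = J y}) = card (J ` S)"
proof -
  let ?c = "\<lambda>x. {y \<in> S. J x = J y}"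
  have "S // {(x, y). x \<in> S \<and> y \<in> S \<and> J x = J y} = ?c ` S"
    unfolding quotient_def by auto
  moreover have "bij_betw (\<lambda>v. {y \<in> S. v = J y}) (J ` S) (?c ` S)"
    unfolding bij_betw_def by (auto simp: inj_on_def image_image)
  ultimately show ?thesis by (simp add: bij_betw_same_card)
qed

lemma conformal_unique:
  assumes "conformal e W" "conformal e' W" shows "e = e'"
  using conformalD(1)[OF assms(1), of "(1, 0, 0)"] conformalD(1)[OF assms(2), of "(1, 0, 0)"]
  by (simp add: dot_def)

text \<open>Two codes are equivalent if and only if their sets of weight functions agree, and the set of
  weight functions of one code is an orbit. The classes for the norms 1 and -1 are disjoint because a
  weight function determines the norm through its value at a unit vector.\<close>

lemma num_inequivalent_eq_card_orbits:
  assumes n: "n \<ge> 4" "9 * n < 13 * d + 23" "2 * n \<le> 3 * d + 2"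
    and ne: "W0 \<in> weight_class n d e0"
  shows "num_inequivalent n (optimal_lcd_codes_dd2 n 3) =
    card (orbit ` weight_class n d 1) + card (orbit ` weight_class n d (-1))"
proof -
  let ?S = "optimal_lcd_codes_dd2 n 3" and ?G = "{g. \<exists>e. weight n g \<in> weight_class n d e}"
  obtain g0 where g0: "weight n g0 = W0" using weight_class_realized[OF ne n(3)] by blast
  have "d3 n 3 = d"
    by (rule d3_eq[of e0 n g0]) (use weight_classD[OF ne] g0 n(2) in auto)
  then have S: "?S = gen_code n ` ?G" by (rule optimal_codes_eq[OF n(1,2)])
  have inv: "weight_functions n (gen_code n g) = orbit (weight n g)" if "g \<in> ?G" for g
    using that weight_functions_gen_code weight_classD(1) by blast
  have "equivalent_codes n C C' \<longleftrightarrow> weight_functions n C = weight_functions n C'" if "C \<in> ?S" for C C'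
  proof -
    obtain g e where g: "C = gen_code n g" "weight n g \<in> weight_class n d e" using \<open>C \<in> ?S\<close> S by blast
    have "weight n g \<in> weight_functions n C"
      using g weight_classD(1)[OF g(2)] unfolding weight_functions_def by blast
    moreover have "C \<subseteq> carrier_vec n" by (auto simp: g(1) gen_code_def)
    ultimately show ?thesis by (intro equivalent_iff_weight_functions)
  qed
  then have "{(C, C'). C \<in> ?S \<and> C' \<in> ?S \<and> equivalent_codes n C C'} =
      {(C, C'). C \<in> ?S \<and> C' \<in> ?S \<and> weight_functions n C = weight_functions n C'}" by auto
  then have "num_inequivalent n ?S = card (weight_functions n ` ?S)"
    unfolding num_inequivalent_def by (simp only: card_quotient_kernel)
  also have "weight_functions n ` ?S = (\<lambda>g. orbit (weight n g)) ` ?G"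
    unfolding S image_image by (rule image_cong[OF refl inv])
  also have "\<dots> = orbit ` (weight n ` ?G)" by (simp add: image_image)
  also have "weight n ` ?G = weight_class n d 1 \<union> weight_class n d (-1)"
  proof
    have "e = 1 \<or> e = -1" if "W \<in> weight_class n d e" for W e
      using conformalD(2)[OF weight_classD(1)[OF that]] by (cases e rule: gf3_cases) auto
    then show "weight n ` ?G \<subseteq> weight_class n d 1 \<union> weight_class n d (-1)" by blast
    show "weight_class n d 1 \<union> weight_class n d (-1) \<subseteq> weight n ` ?G"
      using weight_class_realized[OF _ n(3)] by blast
  qed
  also have "orbit ` (weight_class n d 1 \<union> weight_class n d (-1)) =
      orbit ` weight_class n d 1 \<union> orbit ` weight_class n d (-1)" by (rule image_Un)
  also have "card \<dots> = card (orbit ` weight_class n d 1) + card (orbit ` weight_class n d (-1))"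
  proof (rule card_Un_disjoint)
    have fin: "finite (orbit ` weight_class n d e)" if "e \<noteq> 0" for e
    proof -
      have "weight_class n d e \<subseteq> (UNIV \<rightarrow>\<^sub>E {..18 * n})"
      proof
        fix W assume W: "W \<in> weight_class n d e"
        have "W a \<le> 18 * n" for a
          using member_le_sum[of a UNIV W] weight_classD(5)[OF W] by simp
        then show "W \<in> UNIV \<rightarrow>\<^sub>E {..18 * n}" by auto
      qed
      then show ?thesis by (meson finite_PiE finite finite_atMost finite_imageI finite_subset)
    qed
    show "finite (orbit ` weight_class n d 1)" "finite (orbit ` weight_class n d (-1))"
      by (rule fin, simp)+
    have ident: "((1, 0, 0), (0, 1, 0), (0, 0, 1)) \<in> orthonormal_frames"
      by (simp add: orthonormal_frames_def dot_def)
    have "False" if V: "V \<in> weight_class n d 1" and W: "W \<in> weight_class n d (-1)" and eq: "orbit V = orbit W" for V W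
    proof -
      obtain X where "X \<in> orbit V" using ident unfolding orbit_def by blast
      moreover have "orbit V \<subseteq> weight_class n d 1" "orbit W \<subseteq> weight_class n d (-1)"
        unfolding orbit_def by (intro image_subsetI weight_class_act[OF V], assumption)
          (intro image_subsetI weight_class_act[OF W], assumption)
      ultimately have "X \<in> weight_class n d 1" "X \<in> weight_class n d (-1)"
        using eq by auto
      then have "1 = (-1 :: gf3)" using conformal_unique weight_classD(1) by metis
      then show False using gf3_minus_one by metis
    qed
    then show "orbit ` weight_class n d 1 \<inter> orbit ` weight_class n d (-1) = {}" by blast
  qed
  finally show ?thesis .
qed

lemma card_orbits_eq:
  assumes "e \<noteq> 0" "13 * d + gap_sum d e + 3 * k = 9 * n"
  shows "card (orbit ` weight_class n d e) = num_canonical k"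
proof -
  have "{L. length L = 13 \<and> 13 * d + gap_sum d e + 3 * sum_list L = 9 * n} = {L. length L = 13 \<and> sum_list L = k}"
    using assms(2) by (intro Collect_cong) linarith
  then show ?thesis by (simp only: card_orbits[OF assms(1)] card_list_orbits)
qed

lemma card_orbits_zero:
  assumes "e \<noteq> 0" "13 * d + gap_sum d e > 9 * n"
  shows "card (orbit ` weight_class n d e) = 0"
proof -
  have "{L. length L = 13 \<and> 13 * d + gap_sum d e + 3 * sum_list L = 9 * n} = {}"
    using assms(2) by auto
  then show ?thesis by (simp only: card_orbits[OF assms(1)] image_empty card.empty)
qed

lemma num_canonical_values:
  "num_canonical 0 = 1" "num_canonical 1 = 3" "num_canonical 2 = 12" "num_canonical 3 = 42"
  "num_canonical 4 = 132"
  by code_simp+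

text \<open>Here \<open>c = 9 n - 13 d\<close> is what is left for gaps and excesses together, and \<open>r\<close> is the part used by
  the gaps.\<close>

definition orbit_count :: "nat \<Rightarrow> nat \<Rightarrow> nat" where
  "orbit_count c r = (if r \<le> c then num_canonical ((c - r) div 3) else 0)"

lemma num_inequivalent_formula:
  assumes n: "n \<ge> 4" "9 * n = 13 * d + c" "c < 23" "2 * n \<le> 3 * d + 2"
    and pos: "orbit_count c (gap_sum d 1) + orbit_count c (gap_sum d (-1)) > 0"
  shows "num_inequivalent n (optimal_lcd_codes_dd2 n 3)
    = orbit_count c (gap_sum d 1) + orbit_count c (gap_sum d (-1))"
proof -
  have "d mod 3 = 0 \<or> d mod 3 = 1 \<or> d mod 3 = 2" by auto
  then have dvd: "(13 * d + gap_sum d 1) mod 3 = 0" "(13 * d + gap_sum d (-1)) mod 3 = 0"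
    using gap_sum_values[of d] by presburger+
  have card: "card (orbit ` weight_class n d e) = orbit_count c (gap_sum d e)"
    if e: "e \<noteq> 0" and m: "(13 * d + gap_sum d e) mod 3 = 0" for e
  proof (cases "gap_sum d e \<le> c")
    case True
    obtain k where k: "13 * d + gap_sum d e = 3 * k" using m by (metis mod_0_imp_dvd dvdE)
    then have "c - gap_sum d e = 3 * (3 * n - k)" using True n(2) by simp
    then have "13 * d + gap_sum d e + 3 * ((c - gap_sum d e) div 3) = 9 * n"
      using True k n(2) by simp
    then show ?thesis using card_orbits_eq[OF e] True by (simp add: orbit_count_def)
  next
    case False
    then show ?thesis using card_orbits_zero[OF e] n(2) by (simp add: orbit_count_def)
  qed
  have c: "card (orbit ` weight_class n d 1) = orbit_count c (gap_sum d 1)"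
    "card (orbit ` weight_class n d (-1)) = orbit_count c (gap_sum d (-1))"
    using card dvd by simp_all
  have "weight_class n d 1 \<noteq> {} \<or> weight_class n d (-1) \<noteq> {}"
    using pos c by (metis add_0 card.empty image_empty less_irrefl)
  then obtain W0 e0 where "W0 \<in> weight_class n d e0" by blast
  moreover have "9 * n < 13 * d + 23" using n by simp
  ultimately show ?thesis using num_inequivalent_eq_card_orbits[OF n(1) _ n(4)] c by metis
qed

section \<open>The counts\<close>

text \<open>For \<open>n = 13 s + t\<close> the optimal minimum weight is \<open>9 s\<close> plus a constant, so \<open>c\<close> depends on \<open>t\<close> only. The
  lower bounds on \<open>s\<close> are exactly the condition \<open>2 n \<le> 3 d + 2\<close>.\<close>

lemma num_inequivalent_cases:
  shows "s \<ge> 1 \<Longrightarrow> num_inequivalent (13 * s) (optimal_lcd_codes_dd2 (13 * s) 3) = 3"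
    and "s \<ge> 3 \<Longrightarrow> num_inequivalent (13 * s + 1) (optimal_lcd_codes_dd2 (13 * s + 1) 3) = 144"
    and "s \<ge> 2 \<Longrightarrow> num_inequivalent (13 * s + 2) (optimal_lcd_codes_dd2 (13 * s + 2) 3) = 15"
    and "s \<ge> 1 \<Longrightarrow> num_inequivalent (13 * s + 3) (optimal_lcd_codes_dd2 (13 * s + 3) 3) = 4"
    and "num_inequivalent (13 * s + 4) (optimal_lcd_codes_dd2 (13 * s + 4) 3) = 1"
    and "s \<ge> 2 \<Longrightarrow> num_inequivalent (13 * s + 5) (optimal_lcd_codes_dd2 (13 * s + 5) 3) = 45"
    and "s \<ge> 1 \<Longrightarrow> num_inequivalent (13 * s + 6) (optimal_lcd_codes_dd2 (13 * s + 6) 3) = 4"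
    and "num_inequivalent (13 * s + 7) (optimal_lcd_codes_dd2 (13 * s + 7) 3) = 1"
    and "s \<ge> 2 \<Longrightarrow> num_inequivalent (13 * s + 8) (optimal_lcd_codes_dd2 (13 * s + 8) 3) = 54"
    and "s \<ge> 1 \<Longrightarrow> num_inequivalent (13 * s + 9) (optimal_lcd_codes_dd2 (13 * s + 9) 3) = 13"
    and "num_inequivalent (13 * s + 10) (optimal_lcd_codes_dd2 (13 * s + 10) 3) = 1"
    and "s \<ge> 2 \<Longrightarrow> num_inequivalent (13 * s + 11) (optimal_lcd_codes_dd2 (13 * s + 11) 3) = 54"
    and "s \<ge> 1 \<Longrightarrow> num_inequivalent (13 * s + 12) (optimal_lcd_codes_dd2 (13 * s + 12) 3) = 15"
proof -
  have mod: "(9 * s + i) mod 3 = i mod 3" for i s :: nat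
    using mod_mult_self3[of "3 * s" 3 i] by simp
  have mod1: "Suc (9 * s) mod 3 = Suc 0" for s :: nat using mod[where i = 1 and s = s] by simp
  have mod2: "Suc (Suc (9 * s)) mod 3 = 2" for s :: nat using mod[where i = 2 and s = s] by simp
  note rules = mod1 mod2 orbit_count_def num_canonical_values num_canonical_values(2)[unfolded One_nat_def] mod
  \<comment> \<open>In the first two cases the minimum weight is \<open>9 s - 1\<close>; the substitution \<open>s = Suc u\<close> avoids
    truncated subtraction.\<close>
  show "num_inequivalent (13 * s) (optimal_lcd_codes_dd2 (13 * s) 3) = 3" if ge: "s \<ge> 1"
  proof -
    obtain u where s: "s = Suc u" using ge by (cases s) auto
    show ?thesis
      using num_inequivalent_formula[of "13 * s" "9 * u + 8" 13] gap_sum_values(5,6)[of "9 * u + 8"]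
      by (simp add: s rules)
  qed
  show "num_inequivalent (13 * s + 1) (optimal_lcd_codes_dd2 (13 * s + 1) 3) = 144" if ge: "s \<ge> 3"
  proof -
    obtain u where s: "s = Suc u" using ge by (cases s) auto
    show ?thesis
      using num_inequivalent_formula[of "13 * s + 1" "9 * u + 8" 22] gap_sum_values(5,6)[of "9 * u + 8"] ge
      by (simp add: s rules)
  qed
  show "num_inequivalent (13 * s + 2) (optimal_lcd_codes_dd2 (13 * s + 2) 3) = 15" if "s \<ge> 2"
    using num_inequivalent_formula[of "13 * s + 2" "9 * s + 0" 18] gap_sum_values(1,2)[of "9 * s + 0"] that
    by (simp add: rules)
  show "num_inequivalent (13 * s + 3) (optimal_lcd_codes_dd2 (13 * s + 3) 3) = 4" if "s \<ge> 1"
    using num_inequivalent_formula[of "13 * s + 3" "9 * s + 1" 14] gap_sum_values(3,4)[of "9 * s + 1"] that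
    by (simp add: rules)
  show "num_inequivalent (13 * s + 4) (optimal_lcd_codes_dd2 (13 * s + 4) 3) = 1"
    using num_inequivalent_formula[of "13 * s + 4" "9 * s + 2" 10] gap_sum_values(5,6)[of "9 * s + 2"]
    by (simp add: rules)
  show "num_inequivalent (13 * s + 5) (optimal_lcd_codes_dd2 (13 * s + 5) 3) = 45" if "s \<ge> 2"
    using num_inequivalent_formula[of "13 * s + 5" "9 * s + 2" 19] gap_sum_values(5,6)[of "9 * s + 2"] that
    by (simp add: rules)
  show "num_inequivalent (13 * s + 6) (optimal_lcd_codes_dd2 (13 * s + 6) 3) = 4" if "s \<ge> 1"
    using num_inequivalent_formula[of "13 * s + 6" "9 * s + 3" 15] gap_sum_values(1,2)[of "9 * s + 3"] that
    by (simp add: rules)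
  show "num_inequivalent (13 * s + 7) (optimal_lcd_codes_dd2 (13 * s + 7) 3) = 1"
    using num_inequivalent_formula[of "13 * s + 7" "9 * s + 4" 11] gap_sum_values(3,4)[of "9 * s + 4"]
    by (simp add: rules)
  show "num_inequivalent (13 * s + 8) (optimal_lcd_codes_dd2 (13 * s + 8) 3) = 54" if "s \<ge> 2"
    using num_inequivalent_formula[of "13 * s + 8" "9 * s + 4" 20] gap_sum_values(3,4)[of "9 * s + 4"] that
    by (simp add: rules)
  show "num_inequivalent (13 * s + 9) (optimal_lcd_codes_dd2 (13 * s + 9) 3) = 13" if "s \<ge> 1"
    using num_inequivalent_formula[of "13 * s + 9" "9 * s + 5" 16] gap_sum_values(5,6)[of "9 * s + 5"] that
    by (simp add: rules)
  show "num_inequivalent (13 * s + 10) (optimal_lcd_codes_dd2 (13 * s + 10) 3) = 1"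
    using num_inequivalent_formula[of "13 * s + 10" "9 * s + 6" 12] gap_sum_values(1,2)[of "9 * s + 6"]
    by (simp add: rules)
  show "num_inequivalent (13 * s + 11) (optimal_lcd_codes_dd2 (13 * s + 11) 3) = 54" if "s \<ge> 2"
    using num_inequivalent_formula[of "13 * s + 11" "9 * s + 6" 21] gap_sum_values(1,2)[of "9 * s + 6"] that
    by (simp add: rules)
  show "num_inequivalent (13 * s + 12) (optimal_lcd_codes_dd2 (13 * s + 12) 3) = 15" if "s \<ge> 1"
    using num_inequivalent_formula[of "13 * s + 12" "9 * s + 7" 17] gap_sum_values(3,4)[of "9 * s + 7"] that
    by (simp add: rules)
qed

theorem proposition7p10:
  shows
    "(\<forall>s\<ge>1. num_inequivalent (13*s) (optimal_lcd_codes_dd2 (13*s) 3) = 3) \<and>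
     (\<forall>s\<ge>3. num_inequivalent (13*s+1) (optimal_lcd_codes_dd2 (13*s+1) 3) = 144) \<and>
     ((\<forall>s\<ge>2. num_inequivalent (13*s+2) (optimal_lcd_codes_dd2 (13*s+2) 3) = 15) \<and>
      (\<forall>s\<ge>1. num_inequivalent (13*s+12) (optimal_lcd_codes_dd2 (13*s+12) 3) = 15)) \<and>
     (\<forall>t\<in>{3,6}. \<forall>s\<ge>1. num_inequivalent (13*s+t) (optimal_lcd_codes_dd2 (13*s+t) 3) = 4) \<and>
     (\<forall>t\<in>{4,7,10}. \<forall>s\<ge>0. num_inequivalent (13*s+t) (optimal_lcd_codes_dd2 (13*s+t) 3) = 1) \<and>
     (\<forall>s\<ge>2. num_inequivalent (13*s+5) (optimal_lcd_codes_dd2 (13*s+5) 3) = 45) \<and>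
     (\<forall>t\<in>{8,11}. \<forall>s\<ge>2. num_inequivalent (13*s+t) (optimal_lcd_codes_dd2 (13*s+t) 3) = 54) \<and>
     (\<forall>s\<ge>1. num_inequivalent (13*s+9) (optimal_lcd_codes_dd2 (13*s+9) 3) = 13)"
  by (intro conjI allI impI ballI; (elim insertE emptyE)?; (hypsubst)?; rule num_inequivalent_cases; assumption)
end
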